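(* Let $M$ be a nonzero right module over a ring $R$, and let $\mathcal{P}$ be the set of square matrices $A$ over $R$ such that, if $A$ is $n\times n$, $A$ gives a non-injective map $M^n\to M^n$. Then, with conditions (P1)–(P7) and (E) on a set of square matrices as defined in the context: (i) $\mathcal{P}$ satisfies (P2), (P5), (P6), (P7) and (E). (ii) A necessary and sufficient condition for $\mathcal{P}$ to satisfy (P1) is: (A) no $n\times (n-1)$ matrix over $R$ induces an injection of abelian groups $M^n\to M^{n-1}$ $(n>0)$. (iii) A sufficient condition for $\mathcal{P}$ to satisfy (P3) is: (B) if $K\subseteq M^n$ ($n>0$) is the kernel of the action on $M^n$ of an $n\times (n-1)$ matrix over $R$, then either (a) every map $M^n\to M$ which is induced by a height-$n$ column vector over $R$, and is nonzero on $K$, is one-to-one on $K$, or (b) no such map is one-to-one on $K$. Thus, if both (A) and (B) hold, then $\mathcal{P}$ is a prime matrix ideal of $R$. Hence if, further, the right $R$-module $M$ is faithful, then $R$ is embeddable in a division ring.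
   Context: Rings are associative with $1$, not necessarily commutative; ring homomorphisms preserve $1$; modules are unital. "Embeddable in a division ring" means there is an injective ring homomorphism into a division ring. Elements of $M^n$ are row vectors, on which $n\times n'$ matrices over $R$ act on the right, giving additive group homomorphisms $M^n\to M^{n'}$. For $n=1$, an $n\times(n-1)$ matrix is the empty $1\times 0$ matrix, inducing the unique map $M\to M^0=\{0\}$. For square matrices $A,B$, $A\oplus B=\begin{pmatrix}A&0\\0&B\end{pmatrix}$. If $A,B$ are square matrices of the same size agreeing except in their $r$-th column (resp. row), the determinantal sum $A\nabla B$ with respect to that column (row) agrees with $A$ and $B$ in all other columns (rows) and has as $r$-th column (row) the sum of those of $A$ and $B$. Conditions on a set $\mathcal{P}$ of square matrices over $R$: (P1) $\mathcal{P}$ contains every $n\times n$ matrix ($n>0$) that can be written as the product of an $n\times (n-1)$ matrix and an $(n-1)\times n$ matrix over $R$. (P2) If $A\in\mathcal{P}$ and $B$ is any square matrix over $R$, then $A\oplus B\in\mathcal{P}$. (P3) If $\mathcal{P}$ contains $n\times n$ matrices $A$, $B$ agreeing except in the $r$-th column for some $r$, then it contains $A\nabla B$ with respect to that column. (P4) If $\mathcal{P}$ contains $n\times n$ matrices $A$, $B$ agreeing except in the $r$-th row for some $r$, then it contains $A\nabla B$ with respect to that row. (P5) If $A\oplus 1\in\mathcal{P}$, where $1$ is the $1\times 1$ matrix with entry $1$, then $A\in\mathcal{P}$. (P6) The $1\times 1$ matrix $1$ is not in $\mathcal{P}$. (P7) If $A\oplus B\in\mathcal{P}$, then $A\in\mathcal{P}$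 or $B\in\mathcal{P}$. (E) For each $n>0$, the set of $n\times n$ matrices in $\mathcal{P}$ is closed under left multiplication by the matrices $I_n\pm e_{ij}$ $(i\neq j)$, where $e_{ij}$ are matrix units. A prime matrix ideal of $R$ is a set of square matrices over $R$ satisfying (P1)–(P7). *)

theory Defs
  imports "Jordan_Normal_Form.VS_Connect"
begin

section \<open>Right modules over a not necessarily commutative ring\<close>

locale right_module =
  fixes act :: "'m::ab_group_add \<Rightarrow> 'r::ring_1 \<Rightarrow> 'm"
  assumes act_add_left: "act (x + y) r = act x r + act y r"
    and act_add_right: "act x (r + s) = act x r + act x s"
    and act_mult: "act x (r * s) = act (act x r) s"
    and act_one: "act x 1 = x"

definition faithful_module :: "('m::ab_group_add \<Rightarrow> 'r::ring_1 \<Rightarrow> 'm) \<Rightarrow> bool" where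
  "faithful_module act \<longleftrightarrow> (\<forall>r. (\<forall>x. act x r = 0) \<longrightarrow> r = 0)"

text \<open>Row vectors over the module are elements of \<^term>\<open>carrier_vec n\<close>; matrices over the ring
  act on them from the right.\<close>

definition vec_act :: "('m::ab_group_add \<Rightarrow> 'r::ring_1 \<Rightarrow> 'm) \<Rightarrow> 'm vec \<Rightarrow> 'r vec \<Rightarrow> 'm" where
  "vec_act act v c = (\<Sum>i\<in>{0..<dim_vec c}. act (v $ i) (c $ i))"

definition mat_act :: "('m::ab_group_add \<Rightarrow> 'r::ring_1 \<Rightarrow> 'm) \<Rightarrow> 'm vec \<Rightarrow> 'r mat \<Rightarrow> 'm vec" where
  "mat_act act v A = vec (dim_col A) (\<lambda>j. vec_act act v (col A j))"

definition mat_act_kernel ::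
    "('m::ab_group_add \<Rightarrow> 'r::ring_1 \<Rightarrow> 'm) \<Rightarrow> 'r mat \<Rightarrow> 'm vec set" where
  "mat_act_kernel act A = {v \<in> carrier_vec (dim_row A). mat_act act v A = 0\<^sub>v (dim_col A)}"

definition noninjective_mats :: "('m::ab_group_add \<Rightarrow> 'r::ring_1 \<Rightarrow> 'm) \<Rightarrow> 'r mat set" where
  "noninjective_mats act =
     {A. square_mat A \<and> \<not> inj_on (\<lambda>v. mat_act act v A) (carrier_vec (dim_row A))}"

section \<open>Conditions on sets of square matrices\<close>

definition mat_dsum :: "'r::zero mat \<Rightarrow> 'r mat \<Rightarrow> 'r mat" where
  "mat_dsum A B =
     four_block_mat A (0\<^sub>m (dim_row A) (dim_col B)) (0\<^sub>m (dim_row B) (dim_col A)) B"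

definition agree_except_col :: "nat \<Rightarrow> 'r mat \<Rightarrow> 'r mat \<Rightarrow> bool" where
  "agree_except_col r A B \<longleftrightarrow>
     (\<forall>i<dim_row A. \<forall>j<dim_col A. j \<noteq> r \<longrightarrow> A $$ (i, j) = B $$ (i, j))"

definition agree_except_row :: "nat \<Rightarrow> 'r mat \<Rightarrow> 'r mat \<Rightarrow> bool" where
  "agree_except_row r A B \<longleftrightarrow>
     (\<forall>i<dim_row A. \<forall>j<dim_col A. i \<noteq> r \<longrightarrow> A $$ (i, j) = B $$ (i, j))"

text \<open>Determinantal sums; meaningful for matrices that agree outside the column (row) \<open>r\<close>.\<close>

definition det_sum_col :: "nat \<Rightarrow> 'r::plus mat \<Rightarrow> 'r mat \<Rightarrow> 'r mat" where
  "det_sum_col r A B = mat (dim_row A) (dim_col A)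
     (\<lambda>(i, j). if j = r then A $$ (i, j) + B $$ (i, j) else A $$ (i, j))"

definition det_sum_row :: "nat \<Rightarrow> 'r::plus mat \<Rightarrow> 'r mat \<Rightarrow> 'r mat" where
  "det_sum_row r A B = mat (dim_row A) (dim_col A)
     (\<lambda>(i, j). if i = r then A $$ (i, j) + B $$ (i, j) else A $$ (i, j))"

definition mat_unit :: "nat \<Rightarrow> nat \<Rightarrow> nat \<Rightarrow> 'r::zero_neq_one mat" where
  "mat_unit n i j = mat n n (\<lambda>(k, l). if k = i \<and> l = j then 1 else 0)"

definition cond_P1 :: "'r::ring_1 mat set \<Rightarrow> bool" where
  "cond_P1 P \<longleftrightarrow> (\<forall>n>0. \<forall>C\<in>carrier_mat n (n - 1). \<forall>D\<in>carrier_mat (n - 1) n. C * D \<in> P)"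

definition cond_P2 :: "'r::ring_1 mat set \<Rightarrow> bool" where
  "cond_P2 P \<longleftrightarrow> (\<forall>A\<in>P. \<forall>B. square_mat B \<longrightarrow> mat_dsum A B \<in> P)"

definition cond_P3 :: "'r::ring_1 mat set \<Rightarrow> bool" where
  "cond_P3 P \<longleftrightarrow> (\<forall>n. \<forall>r<n. \<forall>A\<in>P \<inter> carrier_mat n n. \<forall>B\<in>P \<inter> carrier_mat n n.
     agree_except_col r A B \<longrightarrow> det_sum_col r A B \<in> P)"

definition cond_P4 :: "'r::ring_1 mat set \<Rightarrow> bool" where
  "cond_P4 P \<longleftrightarrow> (\<forall>n. \<forall>r<n. \<forall>A\<in>P \<inter> carrier_mat n n. \<forall>B\<in>P \<inter> carrier_mat n n.
     agree_except_row r A B \<longrightarrow> det_sum_row r A B \<in> P)"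

definition cond_P5 :: "'r::ring_1 mat set \<Rightarrow> bool" where
  "cond_P5 P \<longleftrightarrow> (\<forall>A. square_mat A \<and> mat_dsum A (1\<^sub>m 1) \<in> P \<longrightarrow> A \<in> P)"

definition cond_P6 :: "'r::ring_1 mat set \<Rightarrow> bool" where
  "cond_P6 P \<longleftrightarrow> 1\<^sub>m 1 \<notin> P"

definition cond_P7 :: "'r::ring_1 mat set \<Rightarrow> bool" where
  "cond_P7 P \<longleftrightarrow>
     (\<forall>A B. square_mat A \<and> square_mat B \<and> mat_dsum A B \<in> P \<longrightarrow> A \<in> P \<or> B \<in> P)"

definition cond_E :: "'r::ring_1 mat set \<Rightarrow> bool" where
  "cond_E P \<longleftrightarrow> (\<forall>n>0. \<forall>A\<in>P \<inter> carrier_mat n n. \<forall>i<n. \<forall>j<n. i \<noteq> j \<longrightarrow>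
     (1\<^sub>m n + mat_unit n i j) * A \<in> P \<and> (1\<^sub>m n - mat_unit n i j) * A \<in> P)"

definition prime_matrix_ideal :: "'r::ring_1 mat set \<Rightarrow> bool" where
  "prime_matrix_ideal P \<longleftrightarrow> (\<forall>A\<in>P. square_mat A) \<and>
     cond_P1 P \<and> cond_P2 P \<and> cond_P3 P \<and> cond_P4 P \<and> cond_P5 P \<and> cond_P6 P \<and> cond_P7 P"

section \<open>The conditions on the module\<close>

definition cond_A :: "('m::ab_group_add \<Rightarrow> 'r::ring_1 \<Rightarrow> 'm) \<Rightarrow> bool" where
  "cond_A act \<longleftrightarrow> (\<forall>n>0. \<not> (\<exists>C\<in>carrier_mat n (n - 1).
     inj_on (\<lambda>v. mat_act act v C) (carrier_vec n)))"

text \<open>A map is nonzero on a set if it does not vanish identically there.\<close>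

definition cond_B :: "('m::ab_group_add \<Rightarrow> 'r::ring_1 \<Rightarrow> 'm) \<Rightarrow> bool" where
  "cond_B act \<longleftrightarrow> (\<forall>n>0. \<forall>C\<in>carrier_mat n (n - 1). let K = mat_act_kernel act C in
     (\<forall>c\<in>carrier_vec n. (\<exists>v\<in>K. vec_act act v c \<noteq> 0) \<longrightarrow> inj_on (\<lambda>v. vec_act act v c) K) \<or>
     (\<forall>c\<in>carrier_vec n. (\<exists>v\<in>K. vec_act act v c \<noteq> 0) \<longrightarrow> \<not> inj_on (\<lambda>v. vec_act act v c) K))"

section \<open>Embeddability in a division ring\<close>

locale division_ring_structure = ring D for D (structure) +
  assumes Units_eq: "Units D = carrier D - {\<zero>}"

text \<open>HOL cannot quantify existentially over types, so the carrier of the division ring has to live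
  in a fixed type. This loses nothing: if \<open>R\<close> embeds in any division ring, it embeds in the
  division subring generated by its image, which has at most \<open>max(|R|, \<aleph>\<^sub>0)\<close>
  elements and hence is isomorphic to a structure on a subset of \<^typ>\<open>'a mat set\<close>.\<close>

definition embeddable_in_division_ring :: "'a ring \<Rightarrow> bool" where
  "embeddable_in_division_ring R \<longleftrightarrow>
     (\<exists>D :: 'a mat set ring. division_ring_structure D \<and>
        (\<exists>f\<in>Ring.ring_hom R D. inj_on f (carrier R)))"

end

theory Submission
  imports Defs
begin

text \<open>The division ring is built directly from the module, without Cohn's theorem on prime matrix
  ideals. Consider the relations \<open>{(v c, v d) | v \<in> K}\<close> on \<open>M\<close>, where \<open>K \<subseteq> M\<^sup>n\<close> is the kernel of an
  \<open>n \<times> (n - 1)\<close> matrix and \<open>c, d\<close> are columns such that \<open>v \<mapsto> v c\<close> is one-to-one on \<open>K\<close>. They are partial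
  additive maps. By (A), \<open>K\<close> is nonzero, so alternative (a) of (B) holds for \<open>K\<close>, and each such partial
  map is zero or one-to-one; in the second case its inverse is of the same form. Sums and composites
  are again of this form because a fibre product of two such kernels is the kernel of a matrix with
  one row more than columns; in particular their domains are nonzero. Identifying partial maps that
  agree on a common domain therefore gives a division ring, in which \<open>R\<close> embeds if \<open>M\<close> is faithful.

  For (P4), the same dichotomy replaces linear algebra over that division ring: an injective
  \<open>k \<times> l\<close> matrix has \<open>k\<close> columns that are jointly injective.\<close>

section \<open>Kernels of matrices acting on a module\<close>

lemma sum_lessThan_add:
  fixes f :: "nat \<Rightarrow> 'a::comm_monoid_add"
  shows "(\<Sum>i<n + m. f i) = (\<Sum>i<n. f i) + (\<Sum>i<m. f (n + i))"
  by (induction m) (simp_all add: add.assoc)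

context right_module
begin

section \<open>Rules for the module action and for products of rows with columns\<close>

lemma act_zero_left [simp]: "act 0 r = 0"
  using act_add_left[of 0 0 r] by simp

lemma act_zero_right [simp]: "act x 0 = 0"
  using act_add_right[of x 0 0] by simp

lemma act_minus_left: "act (- x) r = - act x r"
  using act_add_left[of x "- x" r] by (simp add: eq_neg_iff_add_eq_0 add.commute)

lemma act_minus_right: "act x (- r) = - act x r"
  using act_add_right[of x r "- r"] by (simp add: eq_neg_iff_add_eq_0 add.commute)

lemma act_diff_left: "act (x - y) r = act x r - act y r"
  using act_add_left[of x "- y" r] by (simp add: act_minus_left)

lemma act_diff_right: "act x (r - s) = act x r - act x s"
  using act_add_right[of x r "- s"] by (simp add: act_minus_right)

lemma act_sum_left: "act (sum f X) r = (\<Sum>x\<in>X. act (f x) r)"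
  by (induction X rule: infinite_finite_induct) (simp_all add: act_add_left)

lemma act_sum_right: "act x (sum f X) = (\<Sum>y\<in>X. act x (f y))"
  by (induction X rule: infinite_finite_induct) (simp_all add: act_add_right)

text \<open>Product of a row over the module with a column over the ring, both given as functions.
  Values outside \<open>X\<close> do not enter, so functions that agree on \<open>X\<close> stand
  for the same vector.\<close>

definition lin :: "'x set \<Rightarrow> ('x \<Rightarrow> 'm) \<Rightarrow> ('x \<Rightarrow> 'r) \<Rightarrow> 'm" where
  "lin X v c = (\<Sum>x\<in>X. act (v x) (c x))"

lemma lin_cong:
  "X = Y \<Longrightarrow> (\<And>x. x \<in> Y \<Longrightarrow> v x = w x) \<Longrightarrow> (\<And>x. x \<in> Y \<Longrightarrow> c x = d x) \<Longrightarrow> lin X v c = lin Y w d"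
  unfolding lin_def by (rule sum.cong) simp_all

text \<open>As a congruence rule this lets the simplifier use membership in the index set when it
  rewrites entries.\<close>

lemma lin_cong_simp [cong]:
  "X = Y \<Longrightarrow> (\<And>x. x \<in> Y =simp=> v x = w x) \<Longrightarrow> (\<And>x. x \<in> Y =simp=> c x = d x) \<Longrightarrow> lin X v c = lin Y w d"
  unfolding simp_implies_def by (rule lin_cong)

lemma lin_zero_left [simp]: "lin X (\<lambda>x. 0) c = 0"
  and lin_zero_right [simp]: "lin X v (\<lambda>x. 0) = 0"
  by (simp_all add: lin_def)

lemma lin_add_left: "lin X (\<lambda>x. v x + w x) c = lin X v c + lin X w c"
  and lin_add_right: "lin X v (\<lambda>x. c x + d x) = lin X v c + lin X v d"
  and lin_diff_left: "lin X (\<lambda>x. v x - w x) c = lin X v c - lin X w c"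
  and lin_minus_right: "lin X v (\<lambda>x. - c x) = - lin X v c"
  by (simp_all add: lin_def act_add_left act_add_right act_diff_left act_minus_right
      sum.distrib sum_subtractf sum_negf)

lemma lin_reindex:
  assumes "bij_betw h X Y"
  shows "lin X (\<lambda>x. v (h x)) (\<lambda>x. c (h x)) = lin Y v c"
  unfolding lin_def using sum.reindex_bij_betw[OF assms, of "\<lambda>y. act (v y) (c y)"] .

lemma lin_Plus:
  assumes "finite X" "finite Y"
  shows "lin (X <+> Y) v c = lin X (\<lambda>x. v (Inl x)) (\<lambda>x. c (Inl x)) + lin Y (\<lambda>y. v (Inr y)) (\<lambda>y. c (Inr y))"
  unfolding lin_def by (subst sum.Plus) (use assms in simp_all)

lemma lin_insert:
  "finite X \<Longrightarrow> a \<notin> X \<Longrightarrow> lin (insert a X) v c = act (v a) (c a) + lin X v c"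
  by (simp add: lin_def)

lemma lin_delta:
  "finite X \<Longrightarrow> i \<in> X \<Longrightarrow> lin X v (\<lambda>x. if x = i then 1 else 0) = v i"
  by (simp add: lin_def if_distrib act_one cong: if_cong)

lemma lin_lessThan_add:
  fixes n :: nat
  shows "lin {..<n + m} v c = lin {..<n} v c + lin {..<m} (\<lambda>i. v (n + i)) (\<lambda>i. c (n + i))"
  unfolding lin_def by (rule sum_lessThan_add)

text \<open>Associativity v(CD) = (vC)D, read off in one column of D; it comes from exchanging the
  two sums.\<close>

lemma lin_mult:
  assumes "finite X" "finite Y"
  shows "lin X v (\<lambda>x. \<Sum>y\<in>Y. c x y * d y) = lin Y (\<lambda>y. lin X v (\<lambda>x. c x y)) d"
proof -
  have "lin X v (\<lambda>x. \<Sum>y\<in>Y. c x y * d y) = (\<Sum>x\<in>X. \<Sum>y\<in>Y. act (act (v x) (c x y)) (d y))"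
    by (simp add: lin_def act_sum_right act_mult)
  also have "\<dots> = lin Y (\<lambda>y. lin X v (\<lambda>x. c x y)) d"
    by (subst sum.swap) (simp add: lin_def act_sum_left)
  finally show ?thesis .
qed

section \<open>Non-injective matrices as matrices that kill a nonzero row\<close>

lemma vec_act_lin: "vec_act act v c = lin {..<dim_vec c} (($) v) (($) c)"
  by (simp add: vec_act_def lin_def atLeast0LessThan)

lemma vec_act_diff:
  "v \<in> carrier_vec (dim_vec c) \<Longrightarrow> w \<in> carrier_vec (dim_vec c) \<Longrightarrow>
    vec_act act (v - w) c = vec_act act v c - vec_act act w c"
  by (auto simp: vec_act_def act_diff_left sum_subtractf intro!: sum.cong)

lemma mat_act_eq_zero_iff:
  assumes "C \<in> carrier_mat n m"
  shows "mat_act act v C = 0\<^sub>v m \<longleftrightarrow> (\<forall>j<m. lin {..<n} (($) v) (\<lambda>i. C $$ (i, j)) = 0)"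
  using assms by (auto simp: mat_act_def vec_eq_iff vec_act_lin)

text \<open>The action is additive, so two distinct rows with the same image differ by a nonzero row
  that is killed.\<close>

lemma not_inj_on_mat_act_iff:
  assumes C: "C \<in> carrier_mat n m"
  shows "\<not> inj_on (\<lambda>v. mat_act act v C) (carrier_vec n) \<longleftrightarrow>
    (\<exists>v. (\<exists>i<n. v i \<noteq> 0) \<and> (\<forall>j<m. lin {..<n} v (\<lambda>i. C $$ (i, j)) = 0))" (is "?L \<longleftrightarrow> ?R")
proof
  assume ?L
  then obtain v w where vw: "v \<in> carrier_vec n" "w \<in> carrier_vec n" "v \<noteq> w"
    "mat_act act v C = mat_act act w C"
    by (auto simp: inj_on_def)
  have "lin {..<n} (\<lambda>i. v $ i - w $ i) (\<lambda>i. C $$ (i, j)) = 0" if "j < m" for j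
    using arg_cong[OF vw(4), of "\<lambda>u. u $ j"] that C by (simp add: lin_diff_left mat_act_def vec_act_lin)
  moreover from vw(1-3) have "\<exists>i<n. v $ i - w $ i \<noteq> 0"
    by (auto simp: vec_eq_iff)
  ultimately show ?R
    by (intro exI[of _ "\<lambda>i. v $ i - w $ i"]) blast
next
  assume ?R
  then obtain v where v: "\<exists>i<n. v i \<noteq> 0" "\<forall>j<m. lin {..<n} v (\<lambda>i. C $$ (i, j)) = 0"
    by blast
  have "mat_act act (vec n v) C = mat_act act (0\<^sub>v n) C"
    using v(2) C by (auto simp: mat_act_def vec_act_lin)
  moreover have "vec n v \<noteq> 0\<^sub>v n"
    using v(1) by (auto simp: vec_eq_iff)
  ultimately show ?L
    by (metis inj_onD vec_carrier zero_carrier_vec)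
qed

lemma noninjective_mats_iff:
  "A \<in> noninjective_mats act \<longleftrightarrow> square_mat A \<and>
    (\<exists>v. (\<exists>i<dim_row A. v i \<noteq> 0) \<and> (\<forall>j<dim_row A. lin {..<dim_row A} v (\<lambda>i. A $$ (i, j)) = 0))"
  using not_inj_on_mat_act_iff[of A "dim_row A" "dim_col A"]
  by (auto simp: noninjective_mats_def)

lemma noninjective_matsI:
  assumes "A \<in> carrier_mat n n" "i < n" "v i \<noteq> 0"
    and "\<And>j. j < n \<Longrightarrow> lin {..<n} v (\<lambda>i. A $$ (i, j)) = 0"
  shows "A \<in> noninjective_mats act"
  unfolding noninjective_mats_iff using assms by auto

lemma noninjective_matsE:
  assumes "A \<in> noninjective_mats act" "A \<in> carrier_mat n n"
  obtains v i where "i < n" "v i \<noteq> 0"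
    and "\<And>j. j < n \<Longrightarrow> lin {..<n} v (\<lambda>i. A $$ (i, j)) = 0"
  using assms unfolding noninjective_mats_iff by auto

section \<open>Conditions (P2), (P5), (P6), (P7) and (E)\<close>

lemma lin_dsum:
  assumes "A \<in> carrier_mat n n" "B \<in> carrier_mat m m" "j < n + m"
  shows "lin {..<n + m} v (\<lambda>i. mat_dsum A B $$ (i, j)) =
    (if j < n then lin {..<n} v (\<lambda>i. A $$ (i, j))
     else lin {..<m} (\<lambda>i. v (n + i)) (\<lambda>i. B $$ (i, j - n)))"
  using assms by (auto simp: mat_dsum_def lin_lessThan_add)

lemma mat_dsum_carrier:
  "A \<in> carrier_mat n n \<Longrightarrow> B \<in> carrier_mat m m \<Longrightarrow> mat_dsum A B \<in> carrier_mat (n + m) (n + m)"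
  by (simp add: mat_dsum_def)

lemma cond_P2_noninjective: "cond_P2 (noninjective_mats act)"
  unfolding cond_P2_def
proof (intro ballI allI impI)
  fix A B :: "'r mat"
  assume A: "A \<in> noninjective_mats act" and B: "square_mat B"
  define n m where "n = dim_row A" and "m = dim_row B"
  have An: "A \<in> carrier_mat n n" and Bm: "B \<in> carrier_mat m m"
    using A B by (auto simp: n_def m_def noninjective_mats_def)
  obtain v i where v: "i < n" "v i \<noteq> 0" "\<And>j. j < n \<Longrightarrow> lin {..<n} v (\<lambda>i. A $$ (i, j)) = 0"
    using noninjective_matsE[OF A An] by blast
  \<comment> \<open>A row killed by \<open>A\<close>, extended by zeros, is killed by the block
    sum.\<close>
  show "mat_dsum A B \<in> noninjective_mats act"
    by (rule noninjective_matsI[where i = i and v = "\<lambda>i. if i < n then v i else 0", OF mat_dsum_carrier[OF An Bm]])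
      (use v in \<open>auto simp: lin_dsum[OF An Bm]\<close>)
qed

lemma cond_P6_noninjective: "cond_P6 (noninjective_mats act)"
  unfolding cond_P6_def by (auto simp: noninjective_mats_iff lin_def act_one)

text \<open>A nonzero row killed by the block sum is nonzero in one of its two segments, and each
  segment is killed by the corresponding block.\<close>

lemma cond_P7_noninjective: "cond_P7 (noninjective_mats act)"
  unfolding cond_P7_def
proof (intro allI impI, elim conjE)
  fix A B :: "'r mat"
  assume "square_mat A" "square_mat B" and AB: "mat_dsum A B \<in> noninjective_mats act"
  define n m where "n = dim_row A" and "m = dim_row B"
  have An: "A \<in> carrier_mat n n" and Bm: "B \<in> carrier_mat m m"
    using \<open>square_mat A\<close> \<open>square_mat B\<close> by (auto simp: n_def m_def)
  obtain v i where v: "i < n + m" "v i \<noteq> 0"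
    "\<And>j. j < n + m \<Longrightarrow> lin {..<n + m} v (\<lambda>i. mat_dsum A B $$ (i, j)) = 0"
    using noninjective_matsE[OF AB mat_dsum_carrier[OF An Bm]] by blast
  show "A \<in> noninjective_mats act \<or> B \<in> noninjective_mats act"
  proof (cases "i < n")
    case True
    have "A \<in> noninjective_mats act"
    proof (rule noninjective_matsI[where v = v, OF An True])
      show "lin {..<n} v (\<lambda>i. A $$ (i, j)) = 0" if "j < n" for j
        using v(3)[of j] that by (simp add: lin_dsum[OF An Bm])
    qed (rule v(2))
    then show ?thesis ..
  next
    case False
    have "B \<in> noninjective_mats act"
    proof (rule noninjective_matsI[where v = "\<lambda>i. v (n + i)" and i = "i - n", OF Bm])
      show "lin {..<m} (\<lambda>i. v (n + i)) (\<lambda>i. B $$ (i, j)) = 0" if "j < m" for j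
        using v(3)[of "n + j"] that by (simp add: lin_dsum[OF An Bm])
    qed (use v False in auto)
    then show ?thesis ..
  qed
qed

text \<open>This is (P7) with the 1 x 1 matrix 1 as second summand, which (P6) excludes from the
  set.\<close>

lemma cond_P5_noninjective: "cond_P5 (noninjective_mats act)"
  using cond_P6_noninjective cond_P7_noninjective
  unfolding cond_P5_def cond_P6_def cond_P7_def by (metis carrier_matD one_carrier_mat square_mat.simps)

text \<open>\<open>T\<close> is invertible, and if vA = 0 then (v T^{-1})(TA) = 0.\<close>

lemma elementary_mult_noninjective:
  assumes A: "A \<in> noninjective_mats act" "A \<in> carrier_mat n n" and ij: "i < n" "j < n" "i \<noteq> j"
    and e: "e = 1 \<or> e = - 1"
    and T: "T = mat n n (\<lambda>(k, l). if k = l then 1 else if k = i \<and> l = j then e else 0)"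
  shows "T * A \<in> noninjective_mats act"
proof -
  obtain v k where v: "k < n" "v k \<noteq> 0" "\<And>j. j < n \<Longrightarrow> lin {..<n} v (\<lambda>i. A $$ (i, j)) = 0"
    using noninjective_matsE[OF A] by blast
  \<comment> \<open>This is v T^{-1} with T^{-1} = I - e e_ij, which subtracts
    \<open>act (v i) e\<close> from entry \<open>j\<close>.\<close>
  define w where "w = v(j := v j - act (v i) e)"
  have wT: "lin {..<n} w (\<lambda>x. T $$ (x, l)) = v l" if l: "l < n" for l
  proof -
    have "lin {..<n} w (\<lambda>x. T $$ (x, l)) =
        lin {..<n} w (\<lambda>x. (if x = l then 1 else 0) + (if x = i then if l = j then e else 0 else 0))"
      using l ij by (intro lin_cong) (auto simp: T)
    also have "\<dots> = w l + act (w i) (if l = j then e else 0)"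
      using l ij by (simp add: lin_add_right lin_delta) (simp add: lin_def if_distrib cong: if_cong)
    finally show ?thesis using ij by (auto simp: w_def)
  qed
  have "\<exists>x<n. w x \<noteq> 0"
  proof (rule ccontr)
    assume "\<not> (\<exists>x<n. w x \<noteq> 0)"
    then have "lin {..<n} w (\<lambda>x. T $$ (x, k)) = lin {..<n} (\<lambda>x. 0) (\<lambda>x. T $$ (x, k))"
      by (intro lin_cong) auto
    with wT[OF v(1)] v(2) show False by simp
  qed
  then obtain x where x: "x < n" "w x \<noteq> 0" by blast
  show ?thesis
  proof (rule noninjective_matsI[where v = w and i = x and n = n])
    show "T * A \<in> carrier_mat n n" unfolding T by (rule mult_carrier_mat[OF mat_carrier A(2)])
    fix c assume c: "c < n"
    have "lin {..<n} w (\<lambda>x. (T * A) $$ (x, c)) =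
        lin {..<n} w (\<lambda>x. \<Sum>y<n. T $$ (x, y) * A $$ (y, c))"
      using A(2) c by (intro lin_cong) (auto simp: T scalar_prod_def atLeast0LessThan)
    also have "\<dots> = lin {..<n} v (\<lambda>y. A $$ (y, c))"
      by (simp add: lin_mult wT)
    finally show "lin {..<n} w (\<lambda>x. (T * A) $$ (x, c)) = 0"
      using v(3) c by simp
  qed (use x in auto)
qed

lemma cond_E_noninjective: "cond_E (noninjective_mats act)"
  unfolding cond_E_def
proof (intro allI impI ballI conjI)
  fix n i j and A :: "'r mat"
  assume A: "A \<in> noninjective_mats act \<inter> carrier_mat n n" and ij: "i < n" "j < n" "i \<noteq> j"
  show "(1\<^sub>m n + mat_unit n i j) * A \<in> noninjective_mats act"
    by (rule elementary_mult_noninjective[of A n i j 1])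
      (use A ij in \<open>auto simp: mat_unit_def\<close>)
  show "(1\<^sub>m n - mat_unit n i j) * A \<in> noninjective_mats act"
    by (rule elementary_mult_noninjective[of A n i j "- 1"])
      (use A ij in \<open>auto simp: mat_unit_def\<close>)
qed

section \<open>Condition (P1) and condition (A)\<close>

lemma cond_A_alt:
  "cond_A act \<longleftrightarrow> (\<forall>n>0. \<forall>C\<in>carrier_mat n (n - 1).
    \<exists>v. (\<exists>i<n. v i \<noteq> 0) \<and> (\<forall>j<n - 1. lin {..<n} v (\<lambda>i. C $$ (i, j)) = 0))"
  unfolding cond_A_def using not_inj_on_mat_act_iff by blast

lemma cond_P1_noninjective_iff: "cond_P1 (noninjective_mats act) \<longleftrightarrow> cond_A act"
proof
  assume P1: "cond_P1 (noninjective_mats act)"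
  show "cond_A act"
    unfolding cond_A_alt
  proof (intro allI impI ballI)
    fix n and C :: "'r mat" assume n: "0 < n" and C: "C \<in> carrier_mat n (n - 1)"
    \<comment> \<open>Multiplication by \<open>D\<close> appends a zero column to \<open>C\<close>,
      so \<open>C\<close> and \<open>C * D\<close> kill the same rows.\<close>
    define D :: "'r mat" where "D = mat (n - 1) n (\<lambda>(i, j). if i = j then 1 else 0)"
    have D: "D \<in> carrier_mat (n - 1) n" by (simp add: D_def)
    have CD: "C * D \<in> noninjective_mats act" "C * D \<in> carrier_mat n n"
      using P1 n C D by (auto simp: cond_P1_def)
    obtain v i where v: "i < n" "v i \<noteq> 0" "\<And>j. j < n \<Longrightarrow> lin {..<n} v (\<lambda>i. (C * D) $$ (i, j)) = 0"
      using noninjective_matsE[OF CD] by blast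
    have "lin {..<n} v (\<lambda>i. C $$ (i, j)) = 0" if j: "j < n - 1" for j
    proof -
      have "(C * D) $$ (i, j) = C $$ (i, j)" if "i < n" for i
        using C j that by (simp add: scalar_prod_def D_def if_distrib sum.delta' cong: if_cong)
      then show ?thesis using v(3)[of j] j by simp
    qed
    with v(1,2) show "\<exists>v. (\<exists>i<n. v i \<noteq> 0) \<and> (\<forall>j<n - 1. lin {..<n} v (\<lambda>i. C $$ (i, j)) = 0)"
      by blast
  qed
next
  assume A: "cond_A act"
  show "cond_P1 (noninjective_mats act)"
    unfolding cond_P1_def
  proof (intro allI impI ballI)
    fix n and C D :: "'r mat"
    assume n: "0 < n" and C: "C \<in> carrier_mat n (n - 1)" and D: "D \<in> carrier_mat (n - 1) n"
    obtain v i where v: "i < n" "v i \<noteq> 0" "\<And>j. j < n - 1 \<Longrightarrow> lin {..<n} v (\<lambda>i. C $$ (i, j)) = 0"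
      using A n C unfolding cond_A_alt by blast
    show "C * D \<in> noninjective_mats act"
    proof (rule noninjective_matsI[where v = v and i = i and n = n])
      show "C * D \<in> carrier_mat n n" using C D by simp
      fix j assume j: "j < n"
      have "lin {..<n} v (\<lambda>i. (C * D) $$ (i, j)) =
          lin {..<n} v (\<lambda>i. \<Sum>k<n - 1. C $$ (i, k) * D $$ (k, j))"
        using C D j by (intro lin_cong) (auto simp: scalar_prod_def atLeast0LessThan)
      also have "\<dots> = 0" by (simp add: lin_mult v(3))
      finally show "lin {..<n} v (\<lambda>i. (C * D) $$ (i, j)) = 0" .
    qed (use v in auto)
  qed
qed

section \<open>Injectivity of a column on the kernel of a matrix\<close>

lemma vec_act_vec:
  "vec_act act v (vec n c) = lin {..<n} (($) v) c"
  by (auto simp: vec_act_lin)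

lemma mat_act_kernel_iff:
  assumes "C \<in> carrier_mat n m"
  shows "v \<in> mat_act_kernel act C \<longleftrightarrow>
    v \<in> carrier_vec n \<and> (\<forall>j<m. lin {..<n} (($) v) (\<lambda>i. C $$ (i, j)) = 0)"
  using assms mat_act_eq_zero_iff[OF assms, of v] by (auto simp: mat_act_kernel_def)

lemma inj_on_vec_act_kernel_iff:
  assumes C: "C \<in> carrier_mat n m" and c: "c \<in> carrier_vec n"
  shows "inj_on (\<lambda>v. vec_act act v c) (mat_act_kernel act C) \<longleftrightarrow>
    (\<forall>v\<in>mat_act_kernel act C. vec_act act v c = 0 \<longrightarrow> v = 0\<^sub>v n)" (is "?L \<longleftrightarrow> ?R")
proof
  have "0\<^sub>v n \<in> mat_act_kernel act C" "vec_act act (0\<^sub>v n) c = 0"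
    using c by (auto simp: mat_act_kernel_iff[OF C] vec_act_lin)
  then show "?L \<Longrightarrow> ?R" by (metis inj_onD)
next
  assume R: ?R
  show ?L
  proof (rule inj_onI)
    fix v w assume v: "v \<in> mat_act_kernel act C" and w: "w \<in> mat_act_kernel act C"
      and eq: "vec_act act v c = vec_act act w c"
    have vn: "v \<in> carrier_vec n" and wn: "w \<in> carrier_vec n"
      using v w by (auto simp: mat_act_kernel_iff[OF C])
    have "lin {..<n} (($) (v - w)) d = lin {..<n} (($) v) d - lin {..<n} (($) w) d" for d
      unfolding lin_diff_left[symmetric] using vn wn by (intro lin_cong) auto
    then have "v - w \<in> mat_act_kernel act C"
      using v w by (auto simp: mat_act_kernel_iff[OF C])
    moreover have "vec_act act (v - w) c = 0"
      using vec_act_diff[of v c w] vn wn c eq by auto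
    ultimately have "v - w = 0\<^sub>v n" using R by blast
    then show "v = w" using vn wn by (auto simp: vec_eq_iff)
  qed
qed

text \<open>Rows and columns are indexed by arbitrary finite sets from here on, so that block matrices can be
  written with disjoint sums of index sets.\<close>

definition kern :: "'x set \<Rightarrow> 'y set \<Rightarrow> ('x \<Rightarrow> 'y \<Rightarrow> 'r) \<Rightarrow> ('x \<Rightarrow> 'm) set" where
  "kern X Y a = {v. \<forall>y\<in>Y. lin X v (\<lambda>x. a x y) = 0}"

text \<open>Injectivity of v |-> vc on the kernel, stated as triviality of the null vectors.
  Vanishing is asked on \<open>X\<close> only, since elements of \<open>kern\<close> are
  unconstrained outside \<open>X\<close>.\<close>

definition inj_col :: "'x set \<Rightarrow> 'y set \<Rightarrow> ('x \<Rightarrow> 'y \<Rightarrow> 'r) \<Rightarrow> ('x \<Rightarrow> 'r) \<Rightarrow> bool" where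
  "inj_col X Y a c \<longleftrightarrow> (\<forall>v\<in>kern X Y a. lin X v c = 0 \<longrightarrow> (\<forall>x\<in>X. v x = 0))"

definition zero_col :: "'x set \<Rightarrow> 'y set \<Rightarrow> ('x \<Rightarrow> 'y \<Rightarrow> 'r) \<Rightarrow> ('x \<Rightarrow> 'r) \<Rightarrow> bool" where
  "zero_col X Y a c \<longleftrightarrow> (\<forall>v\<in>kern X Y a. lin X v c = 0)"

section \<open>Change of index sets\<close>

lemma kern_reindex:
  assumes "bij_betw g X X'" "bij_betw h Y Y'"
  shows "(\<lambda>x. v (g x)) \<in> kern X Y (\<lambda>x y. a (g x) (h y)) \<longleftrightarrow> v \<in> kern X' Y' a"
proof -
  have "lin X (\<lambda>x. v (g x)) (\<lambda>x. a (g x) y) = lin X' v (\<lambda>x. a x y)" for y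
    by (rule lin_reindex[OF assms(1)])
  then show ?thesis unfolding kern_def using assms(2) by (auto simp: bij_betw_def)
qed

text \<open>\<open>w\<close> itself need not factor through \<open>g\<close>, because
  \<open>g\<close> may identify points outside \<open>X\<close>. A factorization on \<open>X\<close>
  suffices for \<open>lin\<close> and is given by the inverse of \<open>g\<close> there.\<close>

lemma kern_reindexE:
  assumes "bij_betw g X X'" "bij_betw h Y Y'" "w \<in> kern X Y (\<lambda>x y. a (g x) (h y))"
  obtains v where "v \<in> kern X' Y' a" "\<And>x. x \<in> X \<Longrightarrow> v (g x) = w x"
proof
  let ?v = "\<lambda>z. w (inv_into X g z)"
  have eq: "?v (g x) = w x" if "x \<in> X" for x
    using that bij_betw_inv_into_left[OF assms(1)] by simp
  then show "\<And>x. x \<in> X \<Longrightarrow> ?v (g x) = w x" .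
  have "(\<lambda>x. ?v (g x)) \<in> kern X Y (\<lambda>x y. a (g x) (h y))"
    using assms(3) eq unfolding kern_def by simp
  then show "?v \<in> kern X' Y' a"
    using kern_reindex[OF assms(1,2), of ?v a] by blast
qed

lemma lin_reindex':
  assumes "bij_betw g X X'" "\<And>x. x \<in> X \<Longrightarrow> v (g x) = w x"
  shows "lin X w (\<lambda>x. c (g x)) = lin X' v c"
proof -
  have "lin X w (\<lambda>x. c (g x)) = lin X (\<lambda>x. v (g x)) (\<lambda>x. c (g x))"
    using assms(2) by (intro lin_cong) auto
  then show ?thesis using lin_reindex[OF assms(1)] by simp
qed

lemma inj_col_reindex:
  assumes "bij_betw g X X'" "bij_betw h Y Y'"
  shows "inj_col X Y (\<lambda>x y. a (g x) (h y)) (\<lambda>x. c (g x)) \<longleftrightarrow> inj_col X' Y' a c" (is "?L \<longleftrightarrow> ?R")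
proof
  assume L: ?L
  show ?R
    unfolding inj_col_def
  proof (intro ballI impI)
    fix v z assume v: "v \<in> kern X' Y' a" "lin X' v c = 0" and z: "z \<in> X'"
    have "\<forall>x\<in>X. v (g x) = 0"
      using L v kern_reindex[OF assms, of v a] lin_reindex[OF assms(1), of v c]
      by (auto simp: inj_col_def)
    then show "v z = 0" using z assms(1) by (auto simp: bij_betw_def)
  qed
next
  assume R: ?R
  show ?L
    unfolding inj_col_def
  proof (intro ballI impI)
    fix w x assume w: "w \<in> kern X Y (\<lambda>x y. a (g x) (h y))" "lin X w (\<lambda>x. c (g x)) = 0" and x: "x \<in> X"
    obtain v where v: "v \<in> kern X' Y' a" "\<And>x. x \<in> X \<Longrightarrow> v (g x) = w x"
      using kern_reindexE[OF assms w(1)] by blast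
    have "lin X' v c = 0" using w(2) lin_reindex'[of g X X' v w c] assms(1) v(2) by simp
    then have "v (g x) = 0"
      using R v(1) x assms(1) by (auto simp: inj_col_def bij_betw_def)
    then show "w x = 0" using v(2) x by simp
  qed
qed

lemma zero_col_reindex:
  assumes "bij_betw g X X'" "bij_betw h Y Y'"
  shows "zero_col X Y (\<lambda>x y. a (g x) (h y)) (\<lambda>x. c (g x)) \<longleftrightarrow> zero_col X' Y' a c" (is "?L \<longleftrightarrow> ?R")
proof
  assume ?L
  then show ?R
    unfolding zero_col_def using kern_reindex[OF assms] lin_reindex[OF assms(1)] by metis
next
  assume R: ?R
  show ?L
    unfolding zero_col_def
  proof
    fix w assume w: "w \<in> kern X Y (\<lambda>x y. a (g x) (h y))"
    obtain v where v: "v \<in> kern X' Y' a" "\<And>x. x \<in> X \<Longrightarrow> v (g x) = w x"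
      using kern_reindexE[OF assms w] by blast
    then show "lin X w (\<lambda>x. c (g x)) = 0"
      using R lin_reindex'[of g X X' v w c] assms(1) by (simp add: zero_col_def)
  qed
qed

section \<open>Conditions (A) and (B) for arbitrary finite index sets\<close>

lemma vec_in_kernel_iff:
  "vec n v \<in> mat_act_kernel act (mat n m (\<lambda>(i, j). a i j)) \<longleftrightarrow> v \<in> kern {..<n} {..<m} a"
  by (auto simp: mat_act_kernel_iff[of _ n m] kern_def)

lemma kernel_ball_iff:
  "(\<forall>v\<in>mat_act_kernel act (mat n m (\<lambda>(i, j). a i j)). Q v) \<longleftrightarrow> (\<forall>v\<in>kern {..<n} {..<m} a. Q (vec n v))"
proof -
  have "\<exists>w. v = vec n w" if "v \<in> mat_act_kernel act (mat n m (\<lambda>(i, j). a i j))" for v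
    using that by (intro exI[of _ "($) v"]) (auto simp: mat_act_kernel_def vec_eq_iff)
  then show ?thesis using vec_in_kernel_iff[of n _ m a] by blast
qed

lemma inj_on_vec_act_iff_inj_col:
  "inj_on (\<lambda>v. vec_act act v (vec n c)) (mat_act_kernel act (mat n m (\<lambda>(i, j). a i j))) \<longleftrightarrow>
    inj_col {..<n} {..<m} a c"
  by (subst inj_on_vec_act_kernel_iff[of _ n m])
    (auto simp: kernel_ball_iff inj_col_def vec_act_vec vec_eq_iff)

lemma zero_col_iff_vec_act:
  "(\<exists>v\<in>mat_act_kernel act (mat n m (\<lambda>(i, j). a i j)). vec_act act v (vec n c) \<noteq> 0) \<longleftrightarrow>
    \<not> zero_col {..<n} {..<m} a c"
  using kernel_ball_iff[of n m a "\<lambda>v. vec_act act v (vec n c) = 0"]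
  by (auto simp: zero_col_def vec_act_vec)

lemma cond_B_nat:
  fixes n :: nat
  assumes "cond_B act" "n > 0"
  shows "(\<forall>c. zero_col {..<n} {..<n - 1} a c \<or> inj_col {..<n} {..<n - 1} a c) \<or>
    (\<forall>c. zero_col {..<n} {..<n - 1} a c \<or> \<not> inj_col {..<n} {..<n - 1} a c)"
proof -
  let ?C = "mat n (n - 1) (\<lambda>(i, j). a i j)"
  let ?K = "mat_act_kernel act ?C"
  have "?C \<in> carrier_mat n (n - 1)" by simp
  with assms have "(\<forall>c\<in>carrier_vec n. (\<exists>v\<in>?K. vec_act act v c \<noteq> 0) \<longrightarrow> inj_on (\<lambda>v. vec_act act v c) ?K) \<or>
    (\<forall>c\<in>carrier_vec n. (\<exists>v\<in>?K. vec_act act v c \<noteq> 0) \<longrightarrow> \<not> inj_on (\<lambda>v. vec_act act v c) ?K)"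
    unfolding cond_B_def Let_def by blast
  moreover have "vec n c \<in> carrier_vec n" for c :: "nat \<Rightarrow> 'r" by simp
  moreover note zero_col_iff_vec_act[of n "n - 1" a] inj_on_vec_act_iff_inj_col[of n _ "n - 1" a]
  ultimately show ?thesis by fast
qed

lemma cond_B_finite:
  assumes B: "cond_B act" and X: "finite X" and Y: "finite Y" and card: "card X = Suc (card Y)"
  shows "(\<forall>c. zero_col X Y a c \<or> inj_col X Y a c) \<or> (\<forall>c. zero_col X Y a c \<or> \<not> inj_col X Y a c)"
proof -
  obtain g where g: "bij_betw g {..<card X} X"
    using ex_bij_betw_nat_finite[OF X] unfolding atLeast0LessThan by blast
  obtain h where h: "bij_betw h {..<card X - 1} Y"
    using ex_bij_betw_nat_finite[OF Y] card unfolding atLeast0LessThan by auto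
  note gh = g h
  show ?thesis
  proof -
    let ?z = "zero_col {..<card X} {..<card X - 1} (\<lambda>x y. a (g x) (h y))"
    let ?i = "inj_col {..<card X} {..<card X - 1} (\<lambda>x y. a (g x) (h y))"
    have "(\<forall>c. ?z c \<or> ?i c) \<or> (\<forall>c. ?z c \<or> \<not> ?i c)"
      using cond_B_nat[OF B, of "card X" "\<lambda>x y. a (g x) (h y)"] card by simp
    moreover note inj_col_reindex[OF gh, of a] zero_col_reindex[OF gh, of a]
    ultimately show ?thesis by fast
  qed
qed

lemma cond_A_finite:
  fixes a :: "'x \<Rightarrow> 'y \<Rightarrow> 'r"
  assumes A: "cond_A act" and X: "finite X" and Y: "finite Y" and card: "card X = Suc (card Y)"
  obtains v x where "v \<in> kern X Y a" "x \<in> X" "v x \<noteq> 0"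
proof -
  obtain g where g: "bij_betw g {..<card X} X"
    using ex_bij_betw_nat_finite[OF X] unfolding atLeast0LessThan by blast
  obtain h where h: "bij_betw h {..<card X - 1} Y"
    using ex_bij_betw_nat_finite[OF Y] card unfolding atLeast0LessThan by auto
  note gh = g h
  let ?C = "mat (card X) (card X - 1) (\<lambda>(i, j). a (g i) (h j))"
  have "?C \<in> carrier_mat (card X) (card X - 1)" "card X > 0" using card by simp_all
  then obtain w i where w: "i < card X" "w i \<noteq> 0"
    "\<forall>j<card X - 1. lin {..<card X} w (\<lambda>i. ?C $$ (i, j)) = 0"
    using A unfolding cond_A_alt by blast
  have "w \<in> kern {..<card X} {..<card X - 1} (\<lambda>x y. a (g x) (h y))"
    using w(3) by (simp add: kern_def)
  then obtain v where "v \<in> kern X Y a" "\<And>x. x \<in> {..<card X} \<Longrightarrow> v (g x) = w x"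
    using kern_reindexE[OF gh] by blast
  with w(1,2) that[of v "g i"] gh(1) show thesis by (auto simp: bij_betw_def)
qed

text \<open>By (A) the kernel is nonzero, so the injective column \<open>c\<close> is nonzero on it
  and refutes alternative (b) of (B). Alternative (a) then applies to every column
  \<open>d\<close>.\<close>

lemma zero_or_inj_col:
  assumes "cond_A act" "cond_B act" "finite X" "finite Y" "card X = Suc (card Y)"
    and inj: "inj_col X Y a c"
  shows "zero_col X Y a d \<or> inj_col X Y a d"
proof -
  obtain v x where "v \<in> kern X Y a" "x \<in> X" "v x \<noteq> 0"
    using cond_A_finite[OF assms(1,3-5)] .
  then have "\<not> zero_col X Y a c" using inj by (auto simp: zero_col_def inj_col_def)
  then show ?thesis using cond_B_finite[OF assms(2-5), of a] inj by blast
qed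

section \<open>Condition (P3)\<close>

lemma kern_diff:
  "v \<in> kern X Y a \<Longrightarrow> w \<in> kern X Y a \<Longrightarrow> (\<lambda>x. v x - w x) \<in> kern X Y a"
  by (simp add: kern_def lin_diff_left)

lemma not_inj_col_iff:
  "\<not> inj_col X Y a c \<longleftrightarrow> (\<exists>v\<in>kern X Y a. lin X v c = 0 \<and> (\<exists>x\<in>X. v x \<noteq> 0))"
  by (auto simp: inj_col_def)

text \<open>Singling out column \<open>r\<close> leaves an n x (n - 1) matrix, the format that (B)
  speaks about.\<close>

lemma noninjective_mats_iff_inj_col:
  assumes "A \<in> carrier_mat n n" "r < n"
  shows "A \<in> noninjective_mats act \<longleftrightarrow>
    \<not> inj_col {..<n} ({..<n} - {r}) (\<lambda>i j. A $$ (i, j)) (\<lambda>i. A $$ (i, r))"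
proof -
  have "(\<forall>j<n. lin {..<n} v (\<lambda>i. A $$ (i, j)) = 0) \<longleftrightarrow>
      v \<in> kern {..<n} ({..<n} - {r}) (\<lambda>i j. A $$ (i, j)) \<and> lin {..<n} v (\<lambda>i. A $$ (i, r)) = 0" for v
    using assms(2) by (auto simp: kern_def)
  then show ?thesis
    unfolding noninjective_mats_iff not_inj_col_iff using assms(1) by auto
qed

text \<open>Let K be the common kernel of the columns other than \<open>r\<close>. Both
  \<open>r\<close>-th columns fail to be injective on K. In case (a) both vanish on K, hence so does
  their sum; in case (b) the sum vanishes on K or is not injective there.\<close>

lemma cond_P3_noninjective:
  assumes B: "cond_B act"
  shows "cond_P3 (noninjective_mats act)"
  unfolding cond_P3_def
proof (intro allI impI ballI)
  fix n r and C D :: "'r mat"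
  assume r: "r < n" and CD: "C \<in> noninjective_mats act \<inter> carrier_mat n n"
    "D \<in> noninjective_mats act \<inter> carrier_mat n n" and agree: "agree_except_col r C D"
  define X Y where "X = {..<n}" and "Y = {..<n} - {r}"
  define a where "a i j = C $$ (i, j)" for i j
  define c d where "c i = C $$ (i, r)" and "d i = D $$ (i, r)" for i
  let ?S = "det_sum_col r C D"
  have "lin X v (\<lambda>i. D $$ (i, j)) = lin X v (\<lambda>i. a i j)"
    and "lin X v (\<lambda>i. ?S $$ (i, j)) = lin X v (\<lambda>i. a i j)" if "j \<in> Y" for v j
    using agree CD that
    by (auto simp: X_def Y_def a_def agree_except_col_def det_sum_col_def intro!: lin_cong)
  then have kern_D: "kern X Y (\<lambda>i j. D $$ (i, j)) = kern X Y a"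
    and kern_S: "kern X Y (\<lambda>i j. ?S $$ (i, j)) = kern X Y a"
    unfolding kern_def by simp_all
  have lin_S: "lin X v (\<lambda>i. ?S $$ (i, r)) = lin X v (\<lambda>i. c i + d i)" for v
    using CD r unfolding X_def c_def d_def det_sum_col_def by auto
  have c: "\<not> inj_col X Y a c" and d: "\<not> inj_col X Y a d"
    using CD noninjective_mats_iff_inj_col[OF _ r, of C] noninjective_mats_iff_inj_col[OF _ r, of D] kern_D
    unfolding X_def Y_def a_def c_def d_def inj_col_def by auto
  have "card X = Suc (card Y)" using r by (simp add: X_def Y_def)
  then consider "zero_col X Y a c" "zero_col X Y a d"
    | "zero_col X Y a (\<lambda>i. c i + d i)" | "\<not> inj_col X Y a (\<lambda>i. c i + d i)"
    using cond_B_finite[OF B, of X Y a] c d by (auto simp: X_def Y_def)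
  \<comment> \<open>A sum that vanishes on K is not injective, because K is nonzero: the failure of
    injectivity of \<open>c\<close> provides a nonzero element.\<close>
  then have "\<not> inj_col X Y a (\<lambda>i. c i + d i)"
    using c unfolding not_inj_col_iff by cases (auto simp: zero_col_def lin_add_right)
  moreover have "?S \<in> carrier_mat n n" using CD by (auto simp: det_sum_col_def)
  ultimately show "?S \<in> noninjective_mats act"
    using noninjective_mats_iff_inj_col[OF _ r, of ?S] kern_S lin_S
    unfolding inj_col_def X_def Y_def by auto
qed

section \<open>Jointly injective columns and condition (P4)\<close>

definition trivial_kern :: "'x set \<Rightarrow> 'y set \<Rightarrow> ('x \<Rightarrow> 'y \<Rightarrow> 'r) \<Rightarrow> bool" where
  "trivial_kern X Y a \<longleftrightarrow> (\<forall>v\<in>kern X Y a. \<forall>x\<in>X. v x = 0)"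

lemma lin_insert_zero:
  assumes "finite X" "r \<notin> X" "v r = 0"
  shows "lin (insert r X) v c = lin X v c"
  using assms by (simp add: lin_insert)

text \<open>A kernel element with entry zero at \<open>r\<close> restricts to a kernel element over
  \<open>X\<close>, hence vanishes. The coordinate at \<open>r\<close> is thus an injective column,
  as \<open>zero_or_inj_col\<close> requires.\<close>

lemma inj_col_insert:
  assumes "finite X" "r \<notin> X" "trivial_kern X Y a"
  shows "inj_col (insert r X) Y a (\<lambda>x. if x = r then 1 else 0)"
  unfolding inj_col_def
proof (intro ballI impI)
  fix v x assume v: "v \<in> kern (insert r X) Y a" "lin (insert r X) v (\<lambda>x. if x = r then 1 else 0) = 0"
    and x: "x \<in> insert r X"
  have "v r = 0" using v(2) assms(1) by (simp add: lin_delta)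
  then have "v \<in> kern X Y a"
    using v(1) assms by (simp add: kern_def lin_insert_zero)
  then show "v x = 0" using assms(3) x \<open>v r = 0\<close> by (auto simp: trivial_kern_def)
qed

text \<open>The analogue of choosing a minor of full rank, by induction on the rows: each new row is
  matched by one new column.\<close>

lemma trivial_kern_subset:
  assumes A: "cond_A act" and B: "cond_B act"
    and "finite X" "finite Y" "trivial_kern X Y a"
  shows "\<exists>Z\<subseteq>Y. card Z = card X \<and> trivial_kern X Z a"
  using assms(3,5)
proof (induction X rule: finite_induct)
  case empty
  show ?case by (intro exI[of _ "{}"]) (simp add: trivial_kern_def)
next
  case (insert r X)
  \<comment> \<open>A kernel element for the rows \<open>X\<close> becomes one for all rows when its
    entry at \<open>r\<close> is set to zero.\<close>
  have "trivial_kern X Y a"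
    unfolding trivial_kern_def
  proof (intro ballI)
    fix v x assume v: "v \<in> kern X Y a" and x: "x \<in> X"
    have "lin (insert r X) (v(r := 0)) (\<lambda>x. a x y) = lin X v (\<lambda>x. a x y)" for y
      using insert.hyps by (subst lin_insert_zero) (auto intro!: lin_cong)
    then have "v(r := 0) \<in> kern (insert r X) Y a"
      using v by (simp add: kern_def)
    then have "(v(r := 0)) x = 0"
      using insert.prems x unfolding trivial_kern_def by blast
    moreover have "x \<noteq> r" using x insert.hyps by blast
    ultimately show "v x = 0" by simp
  qed
  then obtain Z where Z: "Z \<subseteq> Y" "card Z = card X" "trivial_kern X Z a"
    using insert.IH by blast
  have finZ: "finite Z" using Z(1) assms(4) by (rule finite_subset)
  have card: "card (insert r X) = Suc (card Z)" using insert.hyps Z(2) by simp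
  have inj: "inj_col (insert r X) Z a (\<lambda>x. if x = r then 1 else 0)"
    by (rule inj_col_insert) (use insert.hyps Z in auto)
  \<comment> \<open>With one row more than columns, (A) gives a nonzero \<open>v\<close> killed by
    \<open>Z\<close>. The columns in \<open>Y\<close> together kill only zero, so some column
    \<open>y\<close> is nonzero at \<open>v\<close>; by the dichotomy it is injective on the kernel
    of \<open>Z\<close>.\<close>
  obtain v x where v: "v \<in> kern (insert r X) Z a" "x \<in> insert r X" "v x \<noteq> 0"
    using cond_A_finite[OF A _ finZ card] insert.hyps(1) by blast
  then have "v \<notin> kern (insert r X) Y a"
    using insert.prems unfolding trivial_kern_def by blast
  then obtain y where y: "y \<in> Y" "lin (insert r X) v (\<lambda>x. a x y) \<noteq> 0"
    by (auto simp: kern_def)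
  then have "\<not> zero_col (insert r X) Z a (\<lambda>x. a x y)" using v(1) by (auto simp: zero_col_def)
  then have injy: "inj_col (insert r X) Z a (\<lambda>x. a x y)"
    using zero_or_inj_col[OF A B _ finZ card inj] insert.hyps(1) by blast
  have "y \<notin> Z" using y v(1) by (auto simp: kern_def)
  have "trivial_kern (insert r X) (insert y Z) a"
    using injy by (auto simp: trivial_kern_def inj_col_def kern_def)
  then show ?case
    using Z(1) y(1) card finZ \<open>y \<notin> Z\<close> by (intro exI[of _ "insert y Z"]) auto
qed

lemma noninjective_mats_iff_trivial_kern:
  assumes "A \<in> carrier_mat n n"
  shows "A \<in> noninjective_mats act \<longleftrightarrow> \<not> trivial_kern {..<n} {..<n} (\<lambda>i j. A $$ (i, j))"
  unfolding noninjective_mats_iff trivial_kern_def kern_def using assms by auto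

text \<open>On the kernel of the columns in \<open>Z\<close> every further column is zero or injective, and a nonzero
  element of the full kernel excludes injectivity.\<close>

lemma kern_eq_of_not_trivial:
  assumes "cond_A act" "cond_B act" and fin: "finite X" "finite Y" "r \<notin> X"
    and Z: "Z \<subseteq> Y" "card Z = card X" "trivial_kern X Z a"
    and not_triv: "\<not> trivial_kern (insert r X) Y a"
  shows "kern (insert r X) Z a \<subseteq> kern (insert r X) Y a"
proof
  fix v assume v: "v \<in> kern (insert r X) Z a"
  obtain u x where u: "u \<in> kern (insert r X) Y a" "x \<in> insert r X" "u x \<noteq> 0"
    using not_triv by (auto simp: trivial_kern_def)
  have uZ: "u \<in> kern (insert r X) Z a" using u(1) Z(1) by (auto simp: kern_def)
  have "lin (insert r X) v (\<lambda>x. a x y) = 0" if y: "y \<in> Y" for y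
  proof -
    have "\<not> inj_col (insert r X) Z a (\<lambda>x. a x y)"
      using u uZ y unfolding not_inj_col_iff kern_def by blast
    then have "zero_col (insert r X) Z a (\<lambda>x. a x y)"
      using zero_or_inj_col[OF assms(1,2) _ finite_subset[OF Z(1) fin(2)] _ inj_col_insert[OF fin(1,3) Z(3)]]
        fin Z(2) by auto
    then show ?thesis using v by (simp add: zero_col_def)
  qed
  then show "v \<in> kern (insert r X) Y a" by (simp add: kern_def)
qed

text \<open>If the common rows \<open>X\<close> already have a nontrivial kernel, a kernel vector
  extends by zero at \<open>r\<close>. Otherwise there are kernel vectors of \<open>a\<close> and of
  \<open>b\<close> with the same nonzero entry at \<open>r\<close>, and adding them outside
  \<open>r\<close> gives a kernel vector of \<open>c\<close>.\<close>

lemma row_sum_not_trivial_kern: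
  fixes a :: "'x \<Rightarrow> 'y \<Rightarrow> 'r"
  assumes A: "cond_A act" and B: "cond_B act" and fin: "finite X" "finite Y" and r: "r \<notin> X"
    and ab: "\<And>x y. x \<in> X \<Longrightarrow> y \<in> Y \<Longrightarrow> b x y = a x y"
    and nota: "\<not> trivial_kern (insert r X) Y a" and notb: "\<not> trivial_kern (insert r X) Y b"
    and ca: "\<And>x y. x \<in> X \<Longrightarrow> y \<in> Y \<Longrightarrow> c x y = a x y"
    and cr: "\<And>y. y \<in> Y \<Longrightarrow> c r y = a r y + b r y"
  shows "\<not> trivial_kern (insert r X) Y c"
proof (cases "trivial_kern X Y a")
  case False
  then obtain v x where v: "v \<in> kern X Y a" "x \<in> X" "v x \<noteq> 0" by (auto simp: trivial_kern_def)
  have "lin (insert r X) (v(r := 0)) (\<lambda>x. c x y) = lin X v (\<lambda>x. a x y)" if "y \<in> Y" for y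
    using fin r that ca by (subst lin_insert_zero) (auto intro!: lin_cong)
  then have "v(r := 0) \<in> kern (insert r X) Y c" using v(1) by (simp add: kern_def)
  then show ?thesis using v(2,3) r unfolding trivial_kern_def by (metis fun_upd_other insertCI)
next
  case True
  then obtain Z where Z: "Z \<subseteq> Y" "card Z = card X" "trivial_kern X Z a"
    using trivial_kern_subset[OF A B fin] by blast
  have finZ: "finite Z" using Z(1) fin(2) by (rule finite_subset)
  have kern_b: "kern X Z b = kern X Z a" using ab Z(1) by (auto simp: kern_def subset_iff)
  then have Zb: "trivial_kern X Z b" using Z(3) by (simp add: trivial_kern_def)
  \<comment> \<open>Block matrix with a copy of the rows \<open>X\<close> for \<open>a\<close>,
    another for \<open>b\<close>, and one shared row made of row \<open>r\<close> of both. Since |Z|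
    = |X|, it has 2|X| + 1 rows and 2|X| columns, so (A) applies.\<close>
  define e :: "('x + 'x) + unit \<Rightarrow> 'y + 'y \<Rightarrow> 'r" where
    "e p q = (case (p, q) of (Inl (Inl x), Inl y) \<Rightarrow> a x y | (Inl (Inr x), Inr y) \<Rightarrow> b x y
      | (Inr _, Inl y) \<Rightarrow> a r y | (Inr _, Inr y) \<Rightarrow> b r y | _ \<Rightarrow> 0)" for p q
  obtain v p where v: "v \<in> kern ((X <+> X) <+> {()}) (Z <+> Z) e" "p \<in> (X <+> X) <+> {()}" "v p \<noteq> 0"
    using cond_A_finite[OF A, of "(X <+> X) <+> {()}" "Z <+> Z" e] fin finZ Z(2)
    by (auto simp: card_Plus)
  \<comment> \<open>The entry at the shared row becomes the common entry at \<open>r\<close> of both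
    vectors.\<close>
  define m where "m = v (Inr ())"
  define va where "va x = (if x = r then m else v (Inl (Inl x)))" for x
  define vb where "vb x = (if x = r then m else v (Inl (Inr x)))" for x
  have eqa: "lin X va (\<lambda>x. a x y) = lin X (\<lambda>x. v (Inl (Inl x))) (\<lambda>x. a x y)"
    and eqb: "lin X vb (\<lambda>x. b x y) = lin X (\<lambda>x. v (Inl (Inr x))) (\<lambda>x. b x y)" for y
    using r by (auto simp: va_def vb_def intro!: lin_cong)
  have va: "va \<in> kern (insert r X) Z a"
    unfolding kern_def
  proof (intro CollectI ballI)
    fix y assume "y \<in> Z"
    then have "lin ((X <+> X) <+> {()}) v (\<lambda>p. e p (Inl y)) = 0"
      using v(1) by (auto simp: kern_def)
    then show "lin (insert r X) va (\<lambda>x. a x y) = 0"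
      using fin r by (simp add: lin_Plus lin_insert e_def eqa) (simp add: lin_def va_def m_def add.commute)
  qed
  have vb: "vb \<in> kern (insert r X) Z b"
    unfolding kern_def
  proof (intro CollectI ballI)
    fix y assume "y \<in> Z"
    then have "lin ((X <+> X) <+> {()}) v (\<lambda>p. e p (Inr y)) = 0"
      using v(1) by (auto simp: kern_def)
    then show "lin (insert r X) vb (\<lambda>x. b x y) = 0"
      using fin r by (simp add: lin_Plus lin_insert e_def eqb) (simp add: lin_def vb_def m_def add.commute)
  qed
  \<comment> \<open>Otherwise both restrictions to \<open>X\<close> lie in trivial kernels, and
    \<open>v\<close> vanishes.\<close>
  have "m \<noteq> 0"
  proof
    assume m: "m = 0"
    have "va \<in> kern X Z a" "vb \<in> kern X Z b"
      using va vb m fin r by (simp_all add: kern_def lin_insert va_def[of r] vb_def[of r])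
    then have "va x = 0 \<and> vb x = 0" if "x \<in> X" for x
      using Z(3) Zb that unfolding trivial_kern_def by blast
    moreover have "x \<noteq> r" if "x \<in> X" for x using that r by blast
    ultimately have "\<forall>x\<in>X. v (Inl (Inl x)) = 0 \<and> v (Inl (Inr x)) = 0"
      unfolding va_def vb_def by simp
    then show False using v(2,3) m by (auto simp: m_def)
  qed
  \<comment> \<open>For a matrix with nontrivial full kernel, killing the columns \<open>Z\<close>
    means killing all of \<open>Y\<close>.\<close>
  have ker: "va \<in> kern (insert r X) Y a" "vb \<in> kern (insert r X) Y b"
    using va vb kern_eq_of_not_trivial[OF A B fin r Z nota] kern_eq_of_not_trivial[OF A B fin r Z(1,2) Zb notb]
    by auto
  \<comment> \<open>Off \<open>r\<close> the two matrices agree, so the entries add up; at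
    \<open>r\<close> the entry \<open>m\<close> is kept, because row \<open>r\<close> of
    \<open>c\<close> is itself the sum.\<close>
  define w where "w x = (if x = r then m else va x + vb x)" for x
  have "lin (insert r X) w (\<lambda>x. c x y) = 0" if y: "y \<in> Y" for y
  proof -
    have "lin X w (\<lambda>x. c x y) = lin X (\<lambda>x. va x + vb x) (\<lambda>x. a x y)"
      using r y ca by (intro lin_cong) (auto simp: w_def)
    also have "\<dots> = lin X va (\<lambda>x. a x y) + lin X vb (\<lambda>x. a x y)"
      by (rule lin_add_left)
    also have "lin X vb (\<lambda>x. a x y) = lin X vb (\<lambda>x. b x y)"
      using ab y by (intro lin_cong) auto
    finally have "lin (insert r X) w (\<lambda>x. c x y) =
        (act m (a r y) + lin X va (\<lambda>x. a x y)) + (act m (b r y) + lin X vb (\<lambda>x. b x y))"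
      using fin r y by (simp add: lin_insert w_def[of r] cr act_add_right)
    also have "\<dots> = lin (insert r X) va (\<lambda>x. a x y) + lin (insert r X) vb (\<lambda>x. b x y)"
      using fin r by (simp add: lin_insert va_def[of r] vb_def[of r])
    also have "\<dots> = 0" using ker y by (simp add: kern_def)
    finally show ?thesis .
  qed
  then have "w \<in> kern (insert r X) Y c" by (simp add: kern_def)
  moreover have "w r \<noteq> 0" using \<open>m \<noteq> 0\<close> by (simp add: w_def)
  ultimately show ?thesis unfolding trivial_kern_def by blast
qed

section \<open>Condition (P4) and the prime matrix ideal\<close>

lemma cond_P4_noninjective:
  assumes "cond_A act" "cond_B act"
  shows "cond_P4 (noninjective_mats act)"
  unfolding cond_P4_def
proof (intro allI impI ballI)
  fix n r and C D :: "'r mat"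
  assume r: "r < n" and CD: "C \<in> noninjective_mats act \<inter> carrier_mat n n"
    "D \<in> noninjective_mats act \<inter> carrier_mat n n" and agree: "agree_except_row r C D"
  have ins: "insert r ({..<n} - {r}) = {..<n}" using r by auto
  have S: "det_sum_row r C D \<in> carrier_mat n n" using CD by (auto simp: det_sum_row_def)
  have nC: "\<not> trivial_kern (insert r ({..<n} - {r})) {..<n} (\<lambda>i j. C $$ (i, j))"
    and nD: "\<not> trivial_kern (insert r ({..<n} - {r})) {..<n} (\<lambda>i j. D $$ (i, j))"
    unfolding ins using CD noninjective_mats_iff_trivial_kern by auto
  have "\<not> trivial_kern (insert r ({..<n} - {r})) {..<n} (\<lambda>i j. det_sum_row r C D $$ (i, j))"
    by (rule row_sum_not_trivial_kern[OF assms _ _ _ _ nC nD])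
      (use r CD agree in \<open>auto simp: agree_except_row_def det_sum_row_def\<close>)
  then show "det_sum_row r C D \<in> noninjective_mats act"
    unfolding noninjective_mats_iff_trivial_kern[OF S] ins .
qed

lemma prime_matrix_ideal_noninjective:
  assumes "cond_A act" "cond_B act"
  shows "prime_matrix_ideal (noninjective_mats act)"
  unfolding prime_matrix_ideal_def
  using assms cond_P1_noninjective_iff cond_P2_noninjective cond_P3_noninjective cond_P4_noninjective
    cond_P5_noninjective cond_P6_noninjective cond_P7_noninjective
  by (auto simp: noninjective_mats_def)

end

section \<open>The division ring of germs of partial maps\<close>

definition graph_plus :: "('m \<times> 'm::plus) set \<Rightarrow> ('m \<times> 'm) set \<Rightarrow> ('m \<times> 'm) set" where
  "graph_plus S T = {(x, y + z) | x y z. (x, y) \<in> S \<and> (x, z) \<in> T}"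

text \<open>The relations in \<open>\<Gamma> ` I\<close> are graphs of additive maps between subgroups of an abelian group. Two
  of them are identified when they agree at some nonzero point, equivalently on the (never trivial)
  intersection of their domains.\<close>

locale partial_map_germs =
  fixes I :: "'i set" and \<Gamma> :: "'i \<Rightarrow> ('m::ab_group_add \<times> 'm) set"
  assumes diff_closed: "S \<in> \<Gamma> ` I \<Longrightarrow> (x, y) \<in> S \<Longrightarrow> (x', y') \<in> S \<Longrightarrow> (x - x', y - y') \<in> S"
    and single_valued: "S \<in> \<Gamma> ` I \<Longrightarrow> (0, y) \<in> S \<Longrightarrow> y = 0"
    and nontrivial: "S \<in> \<Gamma> ` I \<Longrightarrow> \<exists>x y. x \<noteq> 0 \<and> (x, y) \<in> S"
    and zero_or_inj: "S \<in> \<Gamma> ` I \<Longrightarrow> (x, 0) \<in> S \<Longrightarrow> x \<noteq> 0 \<Longrightarrow> (x', y') \<in> S \<Longrightarrow> y' = 0"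
    and plus_closed: "S \<in> \<Gamma> ` I \<Longrightarrow> T \<in> \<Gamma> ` I \<Longrightarrow> graph_plus S T \<in> \<Gamma> ` I"
    and comp_closed: "S \<in> \<Gamma> ` I \<Longrightarrow> T \<in> \<Gamma> ` I \<Longrightarrow> S O T \<in> \<Gamma> ` I"
    and converse_closed: "S \<in> \<Gamma> ` I \<Longrightarrow> (x, y) \<in> S \<Longrightarrow> y \<noteq> 0 \<Longrightarrow> S\<inverse> \<in> \<Gamma> ` I"
    and zero_graph: "range (\<lambda>x. (x, 0)) \<in> \<Gamma> ` I"
    and id_graph: "Id \<in> \<Gamma> ` I"
    and minus_graph: "range (\<lambda>x. (x, - x)) \<in> \<Gamma> ` I"
begin

abbreviation "\<G> \<equiv> \<Gamma> ` I"

lemma functional: "S \<in> \<G> \<Longrightarrow> (x, y) \<in> S \<Longrightarrow> (x, z) \<in> S \<Longrightarrow> y = z"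
  using diff_closed[of S x y x z] single_valued[of S "y - z"] by simp

lemma minus_closed: "S \<in> \<G> \<Longrightarrow> (x, y) \<in> S \<Longrightarrow> (- x, - y) \<in> S"
  using diff_closed[of S x y x y] diff_closed[of S 0 0 x y] by simp

lemma add_closed: "S \<in> \<G> \<Longrightarrow> (x, y) \<in> S \<Longrightarrow> (x', y') \<in> S \<Longrightarrow> (x + x', y + y') \<in> S"
  using diff_closed[of S x y "- x'" "- y'"] minus_closed[of S x' y'] by simp

text \<open>The domain of \<open>graph_plus S T\<close> is the intersection of the two domains, so
  \<open>nontrivial\<close> for the sum yields a nonzero common point.\<close>

lemma common_point:
  assumes "S \<in> \<G>" "T \<in> \<G>"
  obtains x y z where "x \<noteq> 0" "(x, y) \<in> S" "(x, z) \<in> T"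
  using nontrivial[OF plus_closed[OF assms]] by (auto simp: graph_plus_def)

definition agree :: "('m \<times> 'm) set \<Rightarrow> ('m \<times> 'm) set \<Rightarrow> bool" where
  "agree S T \<longleftrightarrow> (\<exists>x y. x \<noteq> 0 \<and> (x, y) \<in> S \<and> (x, y) \<in> T)"

text \<open>The difference, formed by composing \<open>T\<close> with negation, belongs to the
  family. It is zero at a nonzero point, so by \<open>zero_or_inj\<close> it is zero wherever both
  maps are defined.\<close>

lemma agreeD:
  assumes "S \<in> \<G>" "T \<in> \<G>" "agree S T" "(u, y) \<in> S" "(u, z) \<in> T"
  shows "y = z"
proof -
  define W where "W = graph_plus S (T O range (\<lambda>x. (x, - x)))"
  have W: "W \<in> \<G>"
    unfolding W_def by (intro plus_closed comp_closed minus_graph assms)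
  have in_W: "(x, p + - q) \<in> W" if "(x, p) \<in> S" "(x, q) \<in> T" for x p q
    using that unfolding W_def graph_plus_def by blast
  obtain x p where "x \<noteq> 0" "(x, p) \<in> S" "(x, p) \<in> T"
    using assms(3) by (auto simp: agree_def)
  with in_W[of x p p] zero_or_inj[OF W, of x u "y + - z"] in_W[OF assms(4,5)] show ?thesis
    by simp
qed

lemma agree_sym: "agree S T \<Longrightarrow> agree T S"
  by (auto simp: agree_def)

lemma agree_refl: "S \<in> \<G> \<Longrightarrow> agree S S"
  using nontrivial by (auto simp: agree_def)

lemma agreeI:
  assumes "S \<in> \<G>" "T \<in> \<G>" "\<And>x y z. (x, y) \<in> S \<Longrightarrow> (x, z) \<in> T \<Longrightarrow> y = z"
  shows "agree S T"
  using common_point[OF assms(1,2)] assms(3) unfolding agree_def by metis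

text \<open>The comparison takes place at a nonzero point of all three domains, obtained as a common
  point of \<open>graph_plus S T\<close> and \<open>U\<close>.\<close>

lemma agree_trans:
  assumes "S \<in> \<G>" "T \<in> \<G>" "U \<in> \<G>" "agree S T" "agree T U"
  shows "agree S U"
proof -
  obtain x s t where x: "x \<noteq> 0" "(x, s) \<in> graph_plus S T" "(x, t) \<in> U"
    using common_point[OF plus_closed[OF assms(1,2)] assms(3)] .
  then obtain p q where pq: "(x, p) \<in> S" "(x, q) \<in> T" by (auto simp: graph_plus_def)
  have "p = q" "q = t"
    using agreeD[OF assms(1,2,4) pq] agreeD[OF assms(2,3,5) pq(2) x(3)] by simp_all
  with x pq show ?thesis by (auto simp: agree_def)
qed

text \<open>The class of \<open>S\<close>, recorded by indices of its members. With matrices as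
  indices, germs get the type \<open>'r mat set\<close> that
  \<open>embeddable_in_division_ring\<close> prescribes.\<close>

definition germ :: "('m \<times> 'm) set \<Rightarrow> 'i set" where
  "germ S = {i \<in> I. agree S (\<Gamma> i)}"

lemma germ_eq_iff:
  assumes "S \<in> \<G>" "T \<in> \<G>"
  shows "germ S = germ T \<longleftrightarrow> agree S T"
proof
  assume eq: "germ S = germ T"
  obtain i where i: "i \<in> I" "S = \<Gamma> i" using assms(1) by blast
  then have "i \<in> germ T" using agree_refl[OF assms(1)] eq by (auto simp: germ_def)
  then show "agree S T" using i by (simp add: germ_def agree_sym)
next
  assume "agree S T"
  then show "germ S = germ T"
    using assms agree_trans agree_sym unfolding germ_def by blast
qed

lemma germ_eqI:
  "S \<in> \<G> \<Longrightarrow> T \<in> \<G> \<Longrightarrow> (\<And>x y z. (x, y) \<in> S \<Longrightarrow> (x, z) \<in> T \<Longrightarrow> y = z) \<Longrightarrow> germ S = germ T"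
  using agreeI by (simp add: germ_eq_iff)

definition rep :: "'i set \<Rightarrow> ('m \<times> 'm) set" where
  "rep A = \<Gamma> (SOME i. i \<in> A)"

lemma rep_germ:
  assumes "S \<in> \<G>"
  shows "rep (germ S) \<in> \<G>" "agree (rep (germ S)) S"
proof -
  have "germ S \<noteq> {}"
    using assms agree_refl by (auto simp: germ_def)
  then have "(SOME i. i \<in> germ S) \<in> germ S" by (rule some_in_eq[THEN iffD2])
  then show "rep (germ S) \<in> \<G>" "agree (rep (germ S)) S"
    by (auto simp: rep_def germ_def agree_sym)
qed

text \<open>Maps are written on the right, as for a right module: in \<open>S O T\<close> the map
  \<open>S\<close> comes first, which matches x(rs) = (xr)s.\<close>

definition germ_ring :: "'i set ring" where
  "germ_ring = \<lparr>carrier = germ ` \<G>, mult = (\<lambda>A B. germ (rep A O rep B)), one = germ Id,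
     zero = germ (range (\<lambda>x. (x, 0))), add = (\<lambda>A B. germ (graph_plus (rep A) (rep B)))\<rparr>"

lemma carrier_germ_ring: "carrier germ_ring = germ ` \<G>"
  and one_germ_ring: "\<one>\<^bsub>germ_ring\<^esub> = germ Id"
  and zero_germ_ring: "\<zero>\<^bsub>germ_ring\<^esub> = germ (range (\<lambda>x. (x, 0)))"
  by (simp_all add: germ_ring_def)

text \<open>Independence of representatives: at a common point of both composites,
  \<open>agreeD\<close> identifies first the intermediate and then the final values.\<close>

lemma mult_germ_ring:
  assumes "S \<in> \<G>" "T \<in> \<G>"
  shows "germ S \<otimes>\<^bsub>germ_ring\<^esub> germ T = germ (S O T)"
proof -
  note S = rep_germ[OF assms(1)] and T = rep_germ[OF assms(2)]
  have "germ (rep (germ S) O rep (germ T)) = germ (S O T)"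
  proof (rule germ_eqI)
    fix x y z assume "(x, y) \<in> rep (germ S) O rep (germ T)" "(x, z) \<in> S O T"
    then obtain p q where "(x, p) \<in> rep (germ S)" "(p, y) \<in> rep (germ T)" "(x, q) \<in> S" "(q, z) \<in> T"
      by blast
    then show "y = z"
      using agreeD[OF S(1) assms(1) S(2), of x p q] agreeD[OF T(1) assms(2) T(2), of p y z] by simp
  qed (intro comp_closed assms S(1) T(1))+
  then show ?thesis by (simp add: germ_ring_def)
qed

lemma add_germ_ring:
  assumes "S \<in> \<G>" "T \<in> \<G>"
  shows "germ S \<oplus>\<^bsub>germ_ring\<^esub> germ T = germ (graph_plus S T)"
proof -
  note S = rep_germ[OF assms(1)] and T = rep_germ[OF assms(2)]
  have "germ (graph_plus (rep (germ S)) (rep (germ T))) = germ (graph_plus S T)"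
  proof (rule germ_eqI)
    fix x y z assume "(x, y) \<in> graph_plus (rep (germ S)) (rep (germ T))" "(x, z) \<in> graph_plus S T"
    then show "y = z"
      using agreeD[OF S(1) assms(1) S(2), of x] agreeD[OF T(1) assms(2) T(2), of x]
      unfolding graph_plus_def by blast
  qed (intro plus_closed assms S(1) T(1))+
  then show ?thesis by (simp add: germ_ring_def)
qed

lemmas germ_ring_simps = carrier_germ_ring one_germ_ring zero_germ_ring mult_germ_ring add_germ_ring
lemmas graph_closed = plus_closed comp_closed zero_graph id_graph minus_graph

section \<open>Ring axioms and inverses\<close>

lemma abelian_group_germ_ring: "abelian_group germ_ring"
proof (rule abelian_groupI)
  show "\<zero>\<^bsub>germ_ring\<^esub> \<in> carrier germ_ring"
    by (simp add: germ_ring_simps zero_graph)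
next
  fix A B assume "A \<in> carrier germ_ring" "B \<in> carrier germ_ring"
  then obtain S T where [simp]: "S \<in> \<G>" "T \<in> \<G>" and eq: "A = germ S" "B = germ T"
    unfolding carrier_germ_ring by blast
  show "A \<oplus>\<^bsub>germ_ring\<^esub> B \<in> carrier germ_ring"
    unfolding eq by (simp add: germ_ring_simps graph_closed)
  have "germ (graph_plus S T) = germ (graph_plus T S)"
    by (rule arg_cong[of _ _ germ]) (force simp: graph_plus_def add.commute)
  then show "A \<oplus>\<^bsub>germ_ring\<^esub> B = B \<oplus>\<^bsub>germ_ring\<^esub> A"
    unfolding eq by (simp add: germ_ring_simps)
next
  fix A B C assume "A \<in> carrier germ_ring" "B \<in> carrier germ_ring" "C \<in> carrier germ_ring"
  then obtain S T U where [simp]: "S \<in> \<G>" "T \<in> \<G>" "U \<in> \<G>" and eq: "A = germ S" "B = germ T" "C = germ U"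
    unfolding carrier_germ_ring by blast
  have "germ (graph_plus (graph_plus S T) U) = germ (graph_plus S (graph_plus T U))"
  proof (rule germ_eqI)
    fix x y z assume "(x, y) \<in> graph_plus (graph_plus S T) U" "(x, z) \<in> graph_plus S (graph_plus T U)"
    then obtain s t u s' t' u' where "(x, s) \<in> S" "(x, t) \<in> T" "(x, u) \<in> U" "y = s + t + u"
      "(x, s') \<in> S" "(x, t') \<in> T" "(x, u') \<in> U" "z = s' + (t' + u')"
      unfolding graph_plus_def by blast
    then show "y = z"
      using functional[of S x s s'] functional[of T x t t'] functional[of U x u u'] by (simp add: add.assoc)
  qed (simp_all add: graph_closed)
  then show "A \<oplus>\<^bsub>germ_ring\<^esub> B \<oplus>\<^bsub>germ_ring\<^esub> C = A \<oplus>\<^bsub>germ_ring\<^esub> (B \<oplus>\<^bsub>germ_ring\<^esub> C)"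
    unfolding eq by (simp add: germ_ring_simps graph_closed)
next
  fix A assume "A \<in> carrier germ_ring"
  then obtain S where [simp]: "S \<in> \<G>" and eq: "A = germ S"
    unfolding carrier_germ_ring by blast
  have "graph_plus (range (\<lambda>x. (x, 0))) S = S"
    unfolding graph_plus_def by force
  then show "\<zero>\<^bsub>germ_ring\<^esub> \<oplus>\<^bsub>germ_ring\<^esub> A = A"
    unfolding eq by (simp add: germ_ring_simps graph_closed)
  \<comment> \<open>Composition with x |-> -x gives the negative. The sum is zero on the domain of
    \<open>S\<close>, which may be smaller than M, so the equation holds for germs.\<close>
  have "germ (graph_plus (S O range (\<lambda>x. (x, - x))) S) = germ (range (\<lambda>x. (x, 0)))"
    by (rule germ_eqI) (simp_all add: graph_closed,
      auto simp: graph_plus_def dest: functional[OF \<open>S \<in> \<G>\<close>])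
  then show "\<exists>B\<in>carrier germ_ring. B \<oplus>\<^bsub>germ_ring\<^esub> A = \<zero>\<^bsub>germ_ring\<^esub>"
    unfolding eq
    by (intro bexI[of _ "germ (S O range (\<lambda>x. (x, - x)))"]) (simp_all add: germ_ring_simps graph_closed)
qed

lemma monoid_germ_ring: "Group.monoid germ_ring"
proof (rule monoidI)
  show "\<one>\<^bsub>germ_ring\<^esub> \<in> carrier germ_ring"
    by (simp add: germ_ring_simps id_graph)
next
  fix A B assume "A \<in> carrier germ_ring" "B \<in> carrier germ_ring"
  then show "A \<otimes>\<^bsub>germ_ring\<^esub> B \<in> carrier germ_ring"
    unfolding carrier_germ_ring by (auto simp: mult_germ_ring graph_closed)
next
  fix A B C assume "A \<in> carrier germ_ring" "B \<in> carrier germ_ring" "C \<in> carrier germ_ring"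
  then show "A \<otimes>\<^bsub>germ_ring\<^esub> B \<otimes>\<^bsub>germ_ring\<^esub> C = A \<otimes>\<^bsub>germ_ring\<^esub> (B \<otimes>\<^bsub>germ_ring\<^esub> C)"
    unfolding carrier_germ_ring by (auto simp: mult_germ_ring graph_closed O_assoc)
next
  fix A assume "A \<in> carrier germ_ring"
  then show "\<one>\<^bsub>germ_ring\<^esub> \<otimes>\<^bsub>germ_ring\<^esub> A = A" "A \<otimes>\<^bsub>germ_ring\<^esub> \<one>\<^bsub>germ_ring\<^esub> = A"
    unfolding carrier_germ_ring by (auto simp: one_germ_ring mult_germ_ring graph_closed)
qed

lemma ring_germ_ring: "Ring.ring germ_ring"
proof (rule ringI[OF abelian_group_germ_ring monoid_germ_ring])
  fix A B C assume "A \<in> carrier germ_ring" "B \<in> carrier germ_ring" "C \<in> carrier germ_ring"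
  then obtain S T U where [simp]: "S \<in> \<G>" "T \<in> \<G>" "U \<in> \<G>" and eq: "A = germ S" "B = germ T" "C = germ U"
    unfolding carrier_germ_ring by blast
  \<comment> \<open>The right-hand graph may have the smaller domain; on it the values agree because
    \<open>U\<close> is additive.\<close>
  have "germ (graph_plus S T O U) = germ (graph_plus (S O U) (T O U))"
  proof (rule germ_eqI)
    fix x y z assume "(x, y) \<in> graph_plus S T O U" "(x, z) \<in> graph_plus (S O U) (T O U)"
    then obtain p q p' q' r s where pq: "(x, p) \<in> S" "(x, q) \<in> T" "(p + q, y) \<in> U"
      "(x, p') \<in> S" "(x, q') \<in> T" "(p', r) \<in> U" "(q', s) \<in> U" and z: "z = r + s"
      unfolding graph_plus_def by blast
    have "p = p'" "q = q'" using pq functional \<open>S \<in> \<G>\<close> \<open>T \<in> \<G>\<close> by blast+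
    with pq add_closed[of U p' r q' s] functional[of U "p + q" y z] z show "y = z" by simp
  qed (simp_all add: graph_closed)
  then show "(A \<oplus>\<^bsub>germ_ring\<^esub> B) \<otimes>\<^bsub>germ_ring\<^esub> C = A \<otimes>\<^bsub>germ_ring\<^esub> C \<oplus>\<^bsub>germ_ring\<^esub> B \<otimes>\<^bsub>germ_ring\<^esub> C"
    unfolding eq by (simp add: germ_ring_simps graph_closed)
  have "germ (U O graph_plus S T) = germ (graph_plus (U O S) (U O T))"
  proof (rule germ_eqI)
    fix x y z assume "(x, y) \<in> U O graph_plus S T" "(x, z) \<in> graph_plus (U O S) (U O T)"
    then obtain p s t p' p'' s' t' where "(x, p) \<in> U" "(p, s) \<in> S" "(p, t) \<in> T" "y = s + t"
      "(x, p') \<in> U" "(p', s') \<in> S" "(x, p'') \<in> U" "(p'', t') \<in> T" "z = s' + t'"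
      unfolding graph_plus_def by blast
    then show "y = z" using functional[of U x] functional[of S p] functional[of T p] by simp blast
  qed (simp_all add: graph_closed)
  then show "C \<otimes>\<^bsub>germ_ring\<^esub> (A \<oplus>\<^bsub>germ_ring\<^esub> B) = C \<otimes>\<^bsub>germ_ring\<^esub> A \<oplus>\<^bsub>germ_ring\<^esub> C \<otimes>\<^bsub>germ_ring\<^esub> B"
    unfolding eq by (simp add: germ_ring_simps graph_closed)
qed

lemma germ_eq_zero_iff:
  assumes "S \<in> \<G>"
  shows "germ S = germ (range (\<lambda>x. (x, 0))) \<longleftrightarrow> (\<forall>(x, y)\<in>S. y = 0)"
  unfolding germ_eq_iff[OF assms zero_graph]
proof
  assume "agree S (range (\<lambda>x. (x, 0)))"
  then show "\<forall>(x, y)\<in>S. y = 0"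
    using zero_or_inj[OF assms] by (auto simp: agree_def)
next
  assume "\<forall>(x, y)\<in>S. y = 0"
  then show "agree S (range (\<lambda>x. (x, 0)))"
    by (intro agreeI assms zero_graph) auto
qed

text \<open>\<open>S\<close> followed by its converse returns each point of the domain of
  \<open>S\<close> to itself, because the converse is single-valued.\<close>

lemma germ_inverse:
  assumes S: "S \<in> \<G>" and "S\<inverse> \<in> \<G>"
  shows "germ (S O S\<inverse>) = germ Id"
proof (rule germ_eqI)
  fix x y z assume "(x, y) \<in> S O S\<inverse>" "(x, z) \<in> Id"
  then obtain p where "(p, x) \<in> S\<inverse>" "(p, y) \<in> S\<inverse>" "x = z" by blast
  then show "y = z" using functional[OF assms(2)] by blast
qed (intro graph_closed assms)+

lemma division_ring_germ_ring: "division_ring_structure germ_ring"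
proof -
  interpret ring germ_ring by (rule ring_germ_ring)
  have one_neq_zero: "\<one>\<^bsub>germ_ring\<^esub> \<noteq> \<zero>\<^bsub>germ_ring\<^esub>"
    unfolding one_germ_ring zero_germ_ring germ_eq_zero_iff[OF id_graph] using nontrivial[OF id_graph] by auto
  show ?thesis
  proof
    show "Units germ_ring = carrier germ_ring - {\<zero>\<^bsub>germ_ring\<^esub>}"
    proof (intro equalityI subsetI)
      fix A assume A: "A \<in> Units germ_ring"
      then have "A \<noteq> \<zero>\<^bsub>germ_ring\<^esub>"
        using one_neq_zero l_null by (auto simp: Units_def)
      with A show "A \<in> carrier germ_ring - {\<zero>\<^bsub>germ_ring\<^esub>}" by (auto simp: Units_def)
    next
      fix A assume "A \<in> carrier germ_ring - {\<zero>\<^bsub>germ_ring\<^esub>}"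
      then obtain S where S: "S \<in> \<G>" and eq: "A = germ S" and "germ S \<noteq> germ (range (\<lambda>x. (x, 0)))"
        unfolding carrier_germ_ring zero_germ_ring by blast
      \<comment> \<open>A nonzero germ takes a nonzero value, and then the converse of its graph is
        again in the family.\<close>
      then obtain x y where "(x, y) \<in> S" "y \<noteq> 0" using germ_eq_zero_iff[OF S] by blast
      then have S': "S\<inverse> \<in> \<G>" using converse_closed[OF S] by blast
      show "A \<in> Units germ_ring"
        unfolding Units_def mem_Collect_eq
      proof (intro CollectI conjI bexI[of _ "germ (S\<inverse>)"])
        show "germ (S\<inverse>) \<otimes>\<^bsub>germ_ring\<^esub> A = \<one>\<^bsub>germ_ring\<^esub>"
          "A \<otimes>\<^bsub>germ_ring\<^esub> germ (S\<inverse>) = \<one>\<^bsub>germ_ring\<^esub>"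
          using germ_inverse[OF S S'] germ_inverse[OF S'] S S'
          by (simp_all add: germ_ring_simps eq)
      qed (use S S' in \<open>simp_all add: carrier_germ_ring eq\<close>)
    qed
  qed
qed

end

section \<open>Partial maps given by matrices over the ring\<close>

context right_module
begin

definition rel :: "'x set \<Rightarrow> 'y set \<Rightarrow> ('x \<Rightarrow> 'y \<Rightarrow> 'r) \<Rightarrow> ('x \<Rightarrow> 'r) \<Rightarrow> ('x \<Rightarrow> 'r) \<Rightarrow> ('m \<times> 'm) set" where
  "rel X Y a c d = (\<lambda>v. (lin X v c, lin X v d)) ` kern X Y a"

lemma rel_reindex:
  assumes "bij_betw g X X'" "bij_betw h Y Y'"
  shows "rel X Y (\<lambda>x y. a (g x) (h y)) (\<lambda>x. c (g x)) (\<lambda>x. d (g x)) = rel X' Y' a c d"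
proof (intro equalityI subsetI)
  fix p assume "p \<in> rel X Y (\<lambda>x y. a (g x) (h y)) (\<lambda>x. c (g x)) (\<lambda>x. d (g x))"
  then obtain w where w: "w \<in> kern X Y (\<lambda>x y. a (g x) (h y))"
    "p = (lin X w (\<lambda>x. c (g x)), lin X w (\<lambda>x. d (g x)))"
    by (auto simp: rel_def)
  obtain v where v: "v \<in> kern X' Y' a" "\<And>x. x \<in> X \<Longrightarrow> v (g x) = w x"
    using kern_reindexE[OF assms w(1)] by blast
  then show "p \<in> rel X' Y' a c d"
    unfolding rel_def w(2) using lin_reindex'[OF assms(1), of v w] by auto
next
  fix p assume "p \<in> rel X' Y' a c d"
  then obtain v where v: "v \<in> kern X' Y' a" "p = (lin X' v c, lin X' v d)"
    by (auto simp: rel_def)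
  then show "p \<in> rel X Y (\<lambda>x y. a (g x) (h y)) (\<lambda>x. c (g x)) (\<lambda>x. d (g x))"
    unfolding rel_def using kern_reindex[OF assms, of v a]
    by (intro image_eqI[of _ _ "\<lambda>x. v (g x)"]) (simp_all add: lin_reindex[OF assms(1)])
qed

text \<open>The \<open>n \<times> (n + 1)\<close> matrix with last columns \<open>c, d\<close> stands for the additive relation
  sending \<open>v c\<close> to \<open>v d\<close>, where \<open>v\<close> runs over the common kernel of the first \<open>n - 1\<close> columns. Partial
  maps are thus encoded by matrices over \<open>R\<close>, so that germs are sets of matrices.\<close>

definition mat_rel :: "'r mat \<Rightarrow> ('m \<times> 'm) set" where
  "mat_rel N = (let n = dim_row N in
     rel {..<n} {..<n - 1} (\<lambda>i j. N $$ (i, j)) (\<lambda>i. N $$ (i, n - 1)) (\<lambda>i. N $$ (i, n)))"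

text \<open>Injectivity of column n - 1 makes \<open>mat_rel N\<close> the graph of a partial map
  whose domain is a copy of the kernel.\<close>

definition map_mats :: "'r mat set" where
  "map_mats = {N. let n = dim_row N in n > 0 \<and> dim_col N = Suc n \<and>
     inj_col {..<n} {..<n - 1} (\<lambda>i j. N $$ (i, j)) (\<lambda>i. N $$ (i, n - 1))}"

text \<open>Enumerating \<open>X\<close> and \<open>Y\<close> writes the data as one matrix: the
  columns of \<open>a\<close>, then \<open>c\<close>, then \<open>d\<close>.\<close>

lemma rel_mem_mat_rel:
  fixes a :: "'x \<Rightarrow> 'y \<Rightarrow> 'r"
  assumes X: "finite X" and Y: "finite Y" and card: "card X = Suc (card Y)" and inj: "inj_col X Y a c"
  shows "rel X Y a c d \<in> mat_rel ` map_mats"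
proof -
  define n where "n = card X"
  obtain g where g: "bij_betw g {..<n} X"
    using ex_bij_betw_nat_finite[OF X] unfolding atLeast0LessThan n_def by blast
  obtain h where h: "bij_betw h {..<n - 1} Y"
    using ex_bij_betw_nat_finite[OF Y] card unfolding atLeast0LessThan n_def by auto
  define N where "N = mat n (Suc n)
    (\<lambda>(i, j). if j < n - 1 then a (g i) (h j) else if j = n - 1 then c (g i) else d (g i))"
  have n: "n > 0" using card by (simp add: n_def)
  have kern_N: "kern {..<n} {..<n - 1} (\<lambda>i j. N $$ (i, j)) = kern {..<n} {..<n - 1} (\<lambda>x y. a (g x) (h y))"
    unfolding kern_def by (auto simp: N_def)
  have c_N: "lin {..<n} v (\<lambda>i. N $$ (i, n - 1)) = lin {..<n} v (\<lambda>i. c (g i))"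
    and d_N: "lin {..<n} v (\<lambda>i. N $$ (i, n)) = lin {..<n} v (\<lambda>i. d (g i))" for v
    using n by (auto simp: N_def intro!: lin_cong)
  have dim: "dim_row N = n" "dim_col N = Suc n" by (simp_all add: N_def)
  have "inj_col {..<n} {..<n - 1} (\<lambda>i j. N $$ (i, j)) (\<lambda>i. N $$ (i, n - 1))"
    using inj inj_col_reindex[OF g h, of a c] unfolding inj_col_def kern_N c_N by blast
  then have "N \<in> map_mats"
    using n by (simp add: map_mats_def Let_def dim)
  moreover have "mat_rel N = rel X Y a c d"
    unfolding mat_rel_def Let_def dim rel_reindex[OF g h, symmetric] by (simp only: rel_def kern_N c_N d_N)
  ultimately show ?thesis by blast
qed

lemma mat_relE:
  assumes "S \<in> mat_rel ` map_mats"
  obtains X Y :: "nat set" and a c d where "finite X" "finite Y" "card X = Suc (card Y)"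
    "inj_col X Y a c" "S = rel X Y a c d"
proof -
  obtain N where N: "S = mat_rel N" "N \<in> map_mats" using assms by blast
  define n where "n = dim_row N"
  show thesis
    by (rule that[of "{..<n}" "{..<n - 1}" "\<lambda>i j. N $$ (i, j)" "\<lambda>i. N $$ (i, n - 1)" "\<lambda>i. N $$ (i, n)"])
      (use N in \<open>auto simp: map_mats_def mat_rel_def n_def Let_def\<close>)
qed

text \<open>The fibre product of two kernels over the condition that the column \<open>e\<close> on the first agrees with
  the column \<open>f\<close> on the second: one more row and one more column than a block diagonal matrix of the
  two, so again one row more than columns.\<close>

definition glue :: "('x \<Rightarrow> 'y \<Rightarrow> 'r) \<Rightarrow> ('x \<Rightarrow> 'r) \<Rightarrow> ('z \<Rightarrow> 'w \<Rightarrow> 'r) \<Rightarrow> ('z \<Rightarrow> 'r) \<Rightarrow>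
    'x + 'z \<Rightarrow> ('y + 'w) + unit \<Rightarrow> 'r" where
  "glue a e b f p q = (case (p, q) of
     (Inl x, Inl (Inl y)) \<Rightarrow> a x y | (Inr z, Inl (Inr w)) \<Rightarrow> b z w
   | (Inl x, Inr _) \<Rightarrow> e x | (Inr z, Inr _) \<Rightarrow> - f z | _ \<Rightarrow> 0)"

lemma kern_glue:
  assumes "finite X" "finite Z"
  shows "v \<in> kern (X <+> Z) ((Y <+> W) <+> {()}) (glue a e b f) \<longleftrightarrow>
    (\<lambda>x. v (Inl x)) \<in> kern X Y a \<and> (\<lambda>z. v (Inr z)) \<in> kern Z W b \<and>
    lin X (\<lambda>x. v (Inl x)) e = lin Z (\<lambda>z. v (Inr z)) f"
proof -
  have "(\<forall>p\<in>(Y <+> W) <+> {()}. Q p) \<longleftrightarrow> (\<forall>y\<in>Y. Q (Inl (Inl y))) \<and> (\<forall>w\<in>W. Q (Inl (Inr w))) \<and> Q (Inr ())" for Q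
    by auto
  moreover have "lin (X <+> Z) v (\<lambda>p. glue a e b f p (Inl (Inl y))) = lin X (\<lambda>x. v (Inl x)) (\<lambda>x. a x y)"
    and "lin (X <+> Z) v (\<lambda>p. glue a e b f p (Inl (Inr w))) = lin Z (\<lambda>z. v (Inr z)) (\<lambda>z. b z w)"
    and "lin (X <+> Z) v (\<lambda>p. glue a e b f p (Inr ())) =
      lin X (\<lambda>x. v (Inl x)) e - lin Z (\<lambda>z. v (Inr z)) f" for y w
    using assms by (simp_all add: lin_Plus glue_def lin_minus_right)
  ultimately show ?thesis
    unfolding kern_def mem_Collect_eq by (simp only: right_minus_eq)
qed

text \<open>Rows on the glued index set are compatible pairs of kernel elements, and
  \<open>case_sum\<close> combines columns on the two parts. Sums and composites of partial maps are
  special cases.\<close>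

lemma rel_glue:
  fixes a :: "'x \<Rightarrow> 'y \<Rightarrow> 'r" and b :: "'z \<Rightarrow> 'w \<Rightarrow> 'r"
  assumes "finite X" "finite Z"
  shows "rel (X <+> Z) ((Y <+> W) <+> {()}) (glue a e b f) (case_sum c c') (case_sum d d') =
    {(lin X v c + lin Z w c', lin X v d + lin Z w d') | v w.
      v \<in> kern X Y a \<and> w \<in> kern Z W b \<and> lin X v e = lin Z w f}" (is "?L = ?R")
proof (intro equalityI subsetI)
  fix p assume "p \<in> ?L"
  then obtain v where v: "v \<in> kern (X <+> Z) ((Y <+> W) <+> {()}) (glue a e b f)"
    and p: "p = (lin (X <+> Z) v (case_sum c c'), lin (X <+> Z) v (case_sum d d'))"
    unfolding rel_def by blast
  show "p \<in> ?R"
    by (rule CollectI, rule exI[of _ "\<lambda>x. v (Inl x)"], rule exI[of _ "\<lambda>z. v (Inr z)"])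
      (use v assms in \<open>simp add: p kern_glue lin_Plus\<close>)
next
  fix p assume "p \<in> ?R"
  then obtain v w where "v \<in> kern X Y a" "w \<in> kern Z W b" "lin X v e = lin Z w f"
    "p = (lin X v c + lin Z w c', lin X v d + lin Z w d')"
    by blast
  then show "p \<in> ?L"
    unfolding rel_def using assms
    by (intro image_eqI[of _ _ "case_sum v w"]) (simp_all add: kern_glue lin_Plus)
qed

text \<open>If \<open>c\<close> is zero on the first component, that component vanishes. By the
  gluing condition \<open>f\<close> is then zero on the second, which vanishes because
  \<open>f\<close> is injective.\<close>

lemma inj_col_glue:
  assumes "finite X" "finite Z" "inj_col X Y a c" "inj_col Z W b f"
  shows "inj_col (X <+> Z) ((Y <+> W) <+> {()}) (glue a e b f) (case_sum c (\<lambda>z. 0))"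
  unfolding inj_col_def
proof (intro ballI impI)
  fix v p assume v: "v \<in> kern (X <+> Z) ((Y <+> W) <+> {()}) (glue a e b f)"
    "lin (X <+> Z) v (case_sum c (\<lambda>z. 0)) = 0" and p: "p \<in> X <+> Z"
  have k: "(\<lambda>x. v (Inl x)) \<in> kern X Y a" "(\<lambda>z. v (Inr z)) \<in> kern Z W b"
    "lin X (\<lambda>x. v (Inl x)) e = lin Z (\<lambda>z. v (Inr z)) f"
    using v(1) unfolding kern_glue[OF assms(1,2)] by blast+
  have "lin X (\<lambda>x. v (Inl x)) c = 0" using v(2) assms(1,2) by (simp add: lin_Plus)
  then have vX: "\<forall>x\<in>X. v (Inl x) = 0" using k(1) assms(3) by (auto simp: inj_col_def)
  then have "lin X (\<lambda>x. v (Inl x)) e = lin X (\<lambda>x. 0) e" by (intro lin_cong) auto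
  then have "lin Z (\<lambda>z. v (Inr z)) f = 0" using k(3) by simp
  then have "\<forall>z\<in>Z. v (Inr z) = 0" using k(2) assms(4) by (auto simp: inj_col_def)
  with vX p show "v p = 0" by auto
qed

lemma card_glue:
  assumes "finite X" "finite Y" "finite Z" "finite W" "card X = Suc (card Y)" "card Z = Suc (card W)"
  shows "card (X <+> Z) = Suc (card ((Y <+> W) <+> {()}))"
  using assms by (simp add: card_Plus)

lemma graph_plus_mat_rel:
  assumes "S \<in> mat_rel ` map_mats" "T \<in> mat_rel ` map_mats"
  shows "graph_plus S T \<in> mat_rel ` map_mats"
proof -
  obtain X Y :: "nat set" and a c d where S: "finite X" "finite Y" "card X = Suc (card Y)"
    "inj_col X Y a c" "S = rel X Y a c d"
    using mat_relE[OF assms(1)] .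
  obtain Z W :: "nat set" and b e f where T: "finite Z" "finite W" "card Z = Suc (card W)"
    "inj_col Z W b e" "T = rel Z W b e f"
    using mat_relE[OF assms(2)] .
  \<comment> \<open>For the sum, the gluing condition equates the two inputs.\<close>
  have "graph_plus S T = {(lin X v c + lin Z w (\<lambda>z. 0), lin X v d + lin Z w f) | v w.
      v \<in> kern X Y a \<and> w \<in> kern Z W b \<and> lin X v c = lin Z w e}"
  proof (intro equalityI subsetI)
    fix p assume "p \<in> graph_plus S T"
    then obtain v w where "v \<in> kern X Y a" "w \<in> kern Z W b" "lin X v c = lin Z w e"
      "p = (lin X v c, lin X v d + lin Z w f)"
      unfolding S(5) T(5) rel_def graph_plus_def by blast
    then show "p \<in> {(lin X v c + lin Z w (\<lambda>z. 0), lin X v d + lin Z w f) | v w.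
      v \<in> kern X Y a \<and> w \<in> kern Z W b \<and> lin X v c = lin Z w e}"
      unfolding lin_zero_right add_0_right by blast
  next
    fix p assume "p \<in> {(lin X v c + lin Z w (\<lambda>z. 0), lin X v d + lin Z w f) | v w.
      v \<in> kern X Y a \<and> w \<in> kern Z W b \<and> lin X v c = lin Z w e}"
    then obtain v w where vw: "v \<in> kern X Y a" "w \<in> kern Z W b" "lin X v c = lin Z w e"
      "p = (lin X v c, lin X v d + lin Z w f)"
      unfolding lin_zero_right add_0_right by blast
    have "(lin X v c, lin X v d) \<in> S" "(lin X v c, lin Z w f) \<in> T"
      unfolding S(5) T(5) rel_def using vw(1,2) by (blast, simp add: vw(3))
    then show "p \<in> graph_plus S T" unfolding graph_plus_def vw(4) by blast
  qed
  also have "\<dots> = rel (X <+> Z) ((Y <+> W) <+> {()}) (glue a c b e) (case_sum c (\<lambda>z. 0)) (case_sum d f)"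
    by (rule rel_glue[OF S(1) T(1), symmetric])
  also have "\<dots> \<in> mat_rel ` map_mats"
    by (intro rel_mem_mat_rel card_glue inj_col_glue finite_Plus S T) simp
  finally show ?thesis .
qed

lemma relcomp_mat_rel:
  assumes "S \<in> mat_rel ` map_mats" "T \<in> mat_rel ` map_mats"
  shows "S O T \<in> mat_rel ` map_mats"
proof -
  obtain X Y :: "nat set" and a c d where S: "finite X" "finite Y" "card X = Suc (card Y)"
    "inj_col X Y a c" "S = rel X Y a c d"
    using mat_relE[OF assms(1)] .
  obtain Z W :: "nat set" and b e f where T: "finite Z" "finite W" "card Z = Suc (card W)"
    "inj_col Z W b e" "T = rel Z W b e f"
    using mat_relE[OF assms(2)] .
  \<comment> \<open>For the composite, the gluing condition equates the output of \<open>S\<close>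
    with the input of \<open>T\<close>.\<close>
  have "S O T = {(lin X v c + lin Z w (\<lambda>z. 0), lin X v (\<lambda>x. 0) + lin Z w f) | v w.
      v \<in> kern X Y a \<and> w \<in> kern Z W b \<and> lin X v d = lin Z w e}"
  proof (intro equalityI subsetI)
    fix p assume "p \<in> S O T"
    then obtain v w where "v \<in> kern X Y a" "w \<in> kern Z W b" "lin X v d = lin Z w e"
      "p = (lin X v c, lin Z w f)"
      unfolding S(5) T(5) rel_def by blast
    then show "p \<in> {(lin X v c + lin Z w (\<lambda>z. 0), lin X v (\<lambda>x. 0) + lin Z w f) | v w.
      v \<in> kern X Y a \<and> w \<in> kern Z W b \<and> lin X v d = lin Z w e}"
      unfolding lin_zero_right add_0_right add_0_left by blast
  next
    fix p assume "p \<in> {(lin X v c + lin Z w (\<lambda>z. 0), lin X v (\<lambda>x. 0) + lin Z w f) | v w.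
      v \<in> kern X Y a \<and> w \<in> kern Z W b \<and> lin X v d = lin Z w e}"
    then obtain v w where vw: "v \<in> kern X Y a" "w \<in> kern Z W b" "lin X v d = lin Z w e"
      "p = (lin X v c, lin Z w f)"
      unfolding lin_zero_right add_0_right add_0_left by blast
    have "(lin X v c, lin X v d) \<in> S" "(lin X v d, lin Z w f) \<in> T"
      unfolding S(5) T(5) rel_def using vw(1,2) by (blast, simp add: vw(3))
    then show "p \<in> S O T" unfolding vw(4) by blast
  qed
  also have "\<dots> = rel (X <+> Z) ((Y <+> W) <+> {()}) (glue a d b e) (case_sum c (\<lambda>z. 0)) (case_sum (\<lambda>x. 0) f)"
    by (rule rel_glue[OF S(1) T(1), symmetric])
  also have "\<dots> \<in> mat_rel ` map_mats"
    by (intro rel_mem_mat_rel card_glue inj_col_glue finite_Plus S T) simp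
  finally show ?thesis .
qed

text \<open>Action by \<open>r\<close> is the case of one row and no kernel columns: the kernel is
  M, and the two columns are 1 and \<open>r\<close>.\<close>

lemma scalar_mat_rel: "range (\<lambda>x. (x, act x r)) \<in> mat_rel ` map_mats"
proof -
  have kern: "kern {()} {} (\<lambda>x (y :: nat). 0) = UNIV" by (simp add: kern_def)
  have lin: "lin {()} v c = act (v ()) (c ())" for v c by (simp add: lin_def)
  have "range (\<lambda>x. (x, act x r)) = rel {()} {} (\<lambda>x (y :: nat). 0) (\<lambda>x. 1) (\<lambda>x. r)"
  proof (intro equalityI subsetI)
    fix p assume "p \<in> range (\<lambda>x. (x, act x r))"
    then obtain x where "p = (x, act x r)" by blast
    then show "p \<in> rel {()} {} (\<lambda>x (y :: nat). 0) (\<lambda>x. 1) (\<lambda>x. r)"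
      unfolding rel_def kern lin by (intro image_eqI[of _ _ "\<lambda>_. x"]) (simp_all add: act_one)
  qed (auto simp: rel_def lin act_one)
  also have "\<dots> \<in> mat_rel ` map_mats"
    by (rule rel_mem_mat_rel) (auto simp: inj_col_def lin act_one)
  finally show ?thesis .
qed

lemma range_act_one: "range (\<lambda>x. (x, act x 1)) = Id"
  by (auto simp: act_one)

lemma partial_map_germs_mat_rel:
  assumes A: "cond_A act" and B: "cond_B act"
  shows "partial_map_germs map_mats mat_rel"
proof
  fix S assume "S \<in> mat_rel ` map_mats"
  then obtain X Y :: "nat set" and a c d where S: "finite X" "finite Y" "card X = Suc (card Y)"
    "inj_col X Y a c" and eq: "S = rel X Y a c d"
    using mat_relE by blast
  note zi = zero_or_inj_col[OF A B S, of d]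
  obtain v0 x0 where v0: "v0 \<in> kern X Y a" "x0 \<in> X" "v0 x0 \<noteq> 0"
    using cond_A_finite[OF A S(1-3)] by blast
  have zero: "lin X v e = 0" if "\<forall>x\<in>X. v x = 0" for v e
  proof -
    have "lin X v e = lin X (\<lambda>x. 0) e" using that by (intro lin_cong) auto
    then show ?thesis by simp
  qed
  show "(x - x', y - y') \<in> S" if "(x, y) \<in> S" "(x', y') \<in> S" for x y x' y'
  proof -
    obtain v w where "v \<in> kern X Y a" "w \<in> kern X Y a" "x = lin X v c" "y = lin X v d"
      "x' = lin X w c" "y' = lin X w d"
      using \<open>(x, y) \<in> S\<close> \<open>(x', y') \<in> S\<close> by (auto simp: eq rel_def)
    then show ?thesis
      unfolding eq rel_def by (intro image_eqI[OF _ kern_diff[of v X Y a w]]) (simp_all add: lin_diff_left)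
  qed
  show "y = 0" if "(0, y) \<in> S" for y
    using that S(4) zero unfolding eq rel_def inj_col_def by auto
  show "\<exists>x y. x \<noteq> 0 \<and> (x, y) \<in> S"
    using v0 S(4) unfolding eq rel_def inj_col_def by blast
  show "y' = 0" if "(x, 0) \<in> S" "x \<noteq> 0" "(x', y') \<in> S" for x x' y'
  proof -
    obtain v where v: "v \<in> kern X Y a" "lin X v d = 0" "x = lin X v c"
      using \<open>(x, 0) \<in> S\<close> by (auto simp: eq rel_def)
    then have "\<not> inj_col X Y a d"
      using zero[of v c] \<open>x \<noteq> 0\<close> unfolding not_inj_col_iff by blast
    with zi \<open>(x', y') \<in> S\<close> show "y' = 0" by (auto simp: eq rel_def zero_col_def)
  qed
  \<comment> \<open>A nonzero value makes \<open>d\<close> injective by the dichotomy, so exchanging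
    \<open>c\<close> and \<open>d\<close> presents the converse.\<close>
  show "S\<inverse> \<in> mat_rel ` map_mats" if "(x, y) \<in> S" "y \<noteq> 0" for x y
  proof -
    have "inj_col X Y a d" using zi that by (auto simp: eq rel_def zero_col_def)
    moreover have "S\<inverse> = rel X Y a d c" by (auto simp: eq rel_def)
    ultimately show ?thesis using rel_mem_mat_rel[OF S(1-3)] by simp
  qed
next
  show "range (\<lambda>x. (x, 0)) \<in> mat_rel ` map_mats"
    using scalar_mat_rel[of 0] by simp
  show "Id \<in> mat_rel ` map_mats"
    using scalar_mat_rel[of 1] by (simp only: range_act_one)
  show "range (\<lambda>x. (x, - x)) \<in> mat_rel ` map_mats"
    using scalar_mat_rel[of "- 1"] by (simp add: act_minus_right act_one)
  fix S T assume "S \<in> mat_rel ` map_mats" "T \<in> mat_rel ` map_mats"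
  then show "graph_plus S T \<in> mat_rel ` map_mats" "S O T \<in> mat_rel ` map_mats"
    by (rule graph_plus_mat_rel, rule relcomp_mat_rel)
qed

section \<open>The embedding of the ring into the germs\<close>

lemma embeddable_of_faithful:
  assumes A: "cond_A act" and B: "cond_B act" and faithful: "faithful_module act"
  shows "embeddable_in_division_ring (class_ring :: 'r ring)"
proof -
  interpret partial_map_germs map_mats mat_rel
    by (rule partial_map_germs_mat_rel[OF A B])
  define \<phi> where "\<phi> r = germ (range (\<lambda>x. (x, act x r)))" for r
  have "\<phi> \<in> Ring.ring_hom (class_ring :: 'r ring) germ_ring"
  proof (rule ring_hom_memI)
    show "\<phi> r \<in> carrier germ_ring" for r
      unfolding \<phi>_def carrier_germ_ring by (rule imageI[OF scalar_mat_rel])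
    have "range (\<lambda>x. (x, act x r)) O range (\<lambda>x. (x, act x s)) = range (\<lambda>x. (x, act x (r * s)))" for r s
      by (auto simp: act_mult)
    then show "\<phi> (r \<otimes>\<^bsub>class_ring\<^esub> s) = \<phi> r \<otimes>\<^bsub>germ_ring\<^esub> \<phi> s" for r s
      by (simp add: \<phi>_def mult_germ_ring[OF scalar_mat_rel scalar_mat_rel])
    have "graph_plus (range (\<lambda>x. (x, act x r))) (range (\<lambda>x. (x, act x s))) = range (\<lambda>x. (x, act x (r + s)))" for r s
      by (auto simp: graph_plus_def act_add_right)
    then show "\<phi> (r \<oplus>\<^bsub>class_ring\<^esub> s) = \<phi> r \<oplus>\<^bsub>germ_ring\<^esub> \<phi> s" for r s
      by (simp add: \<phi>_def add_germ_ring[OF scalar_mat_rel scalar_mat_rel])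
    show "\<phi> \<one>\<^bsub>class_ring\<^esub> = \<one>\<^bsub>germ_ring\<^esub>"
      by (simp add: \<phi>_def one_germ_ring range_act_one)
  qed
  moreover have "inj_on \<phi> (carrier class_ring)"
  proof (rule inj_onI)
    fix r s assume "\<phi> r = \<phi> s"
    then have agree: "agree (range (\<lambda>x. (x, act x r))) (range (\<lambda>x. (x, act x s)))"
      using germ_eq_iff[OF scalar_mat_rel scalar_mat_rel] by (simp add: \<phi>_def)
    \<comment> \<open>Both graphs are defined on all of M, so equality of germs means that
      \<open>r\<close> and \<open>s\<close> act alike everywhere.\<close>
    have "act x r = act x s" for x
      using agreeD[OF scalar_mat_rel scalar_mat_rel agree, of x] by blast
    then have "\<forall>x. act x (r - s) = 0" by (simp add: act_diff_right)
    then show "r = s" using faithful unfolding faithful_module_def by (metis eq_iff_diff_eq_0)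
  qed
  ultimately show ?thesis
    unfolding embeddable_in_division_ring_def using division_ring_germ_ring by blast
qed

end

theorem lemma19:
  fixes act :: "'m::ab_group_add \<Rightarrow> 'r::ring_1 \<Rightarrow> 'm"
  assumes "right_module act"
    and "\<exists>x::'m. x \<noteq> 0"
  shows
    "(cond_P2 (noninjective_mats act) \<and> cond_P5 (noninjective_mats act) \<and>
      cond_P6 (noninjective_mats act) \<and> cond_P7 (noninjective_mats act) \<and>
      cond_E (noninjective_mats act)) \<and>
     (cond_P1 (noninjective_mats act) \<longleftrightarrow> cond_A act) \<and>
     (cond_B act \<longrightarrow> cond_P3 (noninjective_mats act)) \<and>
     (cond_A act \<and> cond_B act \<longrightarrow> prime_matrix_ideal (noninjective_mats act)) \<and>
     (cond_A act \<and> cond_B act \<and> faithful_module act \<longrightarrow>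
        embeddable_in_division_ring (class_ring :: 'r ring))"
proof -
  interpret right_module act by fact
  show ?thesis
    using cond_P1_noninjective_iff cond_P2_noninjective cond_P3_noninjective cond_P5_noninjective
      cond_P6_noninjective cond_P7_noninjective cond_E_noninjective
      prime_matrix_ideal_noninjective embeddable_of_faithful
    by blast
qed

end
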